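(* For all integers $k\ge 2$ and $n\ge 2k$, it holds that $$\alpha(U(n,k))=\binom{n-1}{k-1}-\binom{n-k-1}{k-1}.$$
   Context: For integers $n\ge 2k$, $U(n,k)$ is the graph whose vertices are the $k$-subsets of $[n]=\{1,\ldots,n\}$ that contain a pair of elements that are consecutive modulo $n$ (i.e., contain $\{j,j+1\}$ for some $1\le j<n$, or contain $\{1,n\}$), with two sets adjacent if and only if they are disjoint. $\alpha(G)$ denotes the independence number of $G$, i.e., the largest size of an independent set of vertices. *)

theory Defs
  imports "Graph_Theory.Pair_Digraph"
begin

(* Finite simple graphs are the symmetric loop-free finite digraphs satisfying pair_graph;
   an undirected edge uv is represented by the two arcs (u, v) and (v, u). *)

definition independent_set :: "'a pair_pre_digraph \<Rightarrow> 'a set \<Rightarrow> bool" where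
  "independent_set G S \<longleftrightarrow> S \<subseteq> pverts G \<and> (\<forall>u\<in>S. \<forall>v\<in>S. (u, v) \<notin> parcs G)"

(* Intended for graphs with finitely many vertices, where Max is over a finite nonempty set. *)
definition independence_number :: "'a pair_pre_digraph \<Rightarrow> nat" where
  "independence_number G = Max {card S | S. independent_set G S}"

definition U_verts :: "nat \<Rightarrow> nat \<Rightarrow> nat set set" where
  "U_verts n k = {A. A \<subseteq> {1..n} \<and> card A = k \<and>
     ((\<exists>j. 1 \<le> j \<and> j < n \<and> {j, j + 1} \<subseteq> A) \<or> {1, n} \<subseteq> A)}"

definition U :: "nat \<Rightarrow> nat \<Rightarrow> nat set pair_pre_digraph" where
  "U n k = \<lparr> pverts = U_verts n k,
             parcs = {(A, B). A \<in> U_verts n k \<and> B \<in> U_verts n k \<and> A \<inter> B = {}} \<rparr>"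

lemma finite_U_verts: "finite (U_verts n k)"
  by (rule finite_subset[of _ "Pow {1..n}"]) (auto simp: U_verts_def)

lemma pair_graph_U: "pair_graph (U n k)"
proof unfold_locales
  show "finite (pverts (U n k))"
    by (simp add: U_def finite_U_verts)
  have "parcs (U n k) \<subseteq> U_verts n k \<times> U_verts n k"
    by (auto simp: U_def)
  then show "finite (parcs (U n k))"
    by (rule finite_subset) (simp add: finite_U_verts)
  have "A \<noteq> {}" if "A \<in> U_verts n k" for A
    using that unfolding U_verts_def by blast
  then show "fst e \<noteq> snd e" if "e \<in> parcs (U n k)" for e
    using that unfolding U_def by force
  have "sym (parcs (U n k))"
    unfolding U_def sym_def by (simp add: Int_commute)
  then show "symmetric (with_proj (U n k))"
    unfolding symmetric_def by simp
  show "fst e \<in> pverts (U n k)" "snd e \<in> pverts (U n k)" if "e \<in> parcs (U n k)" for e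
    using that unfolding U_def by auto
qed

lemma finite_independent_set_cards:
  assumes "finite (pverts G)"
  shows "finite {card S | S. independent_set G S}"
proof -
  have "{card S | S. independent_set G S} \<subseteq> card ` Pow (pverts G)"
    by (auto simp: independent_set_def)
  then show ?thesis
    by (rule finite_subset) (simp add: assms)
qed

lemma independent_set_empty: "independent_set G {}"
  by (simp add: independent_set_def)

end

theory Submission
  imports Defs
begin

text \<open>
  An intersecting family \<open>F\<close> of vertices whose members share a point \<open>x\<close> has at most as many members
  as there are non-stable \<open>k\<close>-sets through \<open>x\<close>; by rotation symmetry this number does not depend on
  \<open>x\<close>, and for \<open>x = 1\<close> counting stable sets on a path gives the formula. If the members of \<open>F\<close> have
  no common point, the Hilton--Milner theorem bounds \<open>F\<close> by one more than the formula, so its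
  equality cases have to be excluded: for \<open>k \<ge> 3\<close> and \<open>n > 2k\<close> every extremal family contains a
  stable set. For \<open>n = 2k\<close> one can add the set of odd numbers to \<open>F\<close> and compare complements, and for
  \<open>k = 2\<close> there are no triangles in a cycle of length at least 4.

  The Hilton--Milner theorem with its equality cases is proved by shifting. If \<open>i\<close> and \<open>j\<close> are such that
  \<open>F\<close> is shifted outside \<open>{i, j}\<close>, then \<open>F\<close> splits into four parts according to the intersection
  with \<open>{i, j}\<close>: a shadow estimate bounds the parts containing both or none of the two points, and
  a bound for cross-intersecting pairs the other two. Equality is carried back along a shift
  because all disjoint sets have to lie on the same side of the shift.
\<close>

section \<open>Links, deletions and shifted families\<close>

definition ksets :: "'a set \<Rightarrow> nat \<Rightarrow> 'a set set" where
  "ksets V k = {A. A \<subseteq> V \<and> card A = k}"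

definition link :: "'a \<Rightarrow> 'a set set \<Rightarrow> 'a set set" where
  "link x F = {A. x \<notin> A \<and> insert x A \<in> F}"

definition del :: "'a \<Rightarrow> 'a set set \<Rightarrow> 'a set set" where
  "del x F = {A \<in> F. x \<notin> A}"

text \<open>Only exchanges inside \<open>V\<close> are demanded, and members may have points outside
  \<open>V\<close>. Thus a family can be shifted away from two special points \<open>i\<close> and
  \<open>j\<close> with no condition at these points.\<close>

definition shifted :: "'a::linorder set \<Rightarrow> 'a set set \<Rightarrow> bool" where
  "shifted V F \<longleftrightarrow> (\<forall>A\<in>F. \<forall>x\<in>A \<inter> V. \<forall>z\<in>V - A. z < x \<longrightarrow> insert z (A - {x}) \<in> F)"

lemma shiftedD:
  "\<lbrakk>shifted V F; A \<in> F; x \<in> A; x \<in> V; z \<in> V; z \<notin> A; z < x\<rbrakk> \<Longrightarrow> insert z (A - {x}) \<in> F"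
  by (auto simp: shifted_def)

lemma finite_del [simp]: "finite F \<Longrightarrow> finite (del x F)"
  by (simp add: del_def)

lemma finite_ksets [simp]: "finite V \<Longrightarrow> finite (ksets V k)"
  by (rule finite_subset[of _ "Pow V"]) (auto simp: ksets_def)

lemma card_ksets: "finite V \<Longrightarrow> card (ksets V k) = card V choose k"
  by (simp add: ksets_def n_subsets)

lemma ksets_0 [simp]: "finite V \<Longrightarrow> ksets V 0 = {{}}"
  by (auto simp: ksets_def finite_subset)

lemma ksets_D: "A \<in> ksets V k \<Longrightarrow> finite V \<Longrightarrow> finite A \<and> A \<subseteq> V \<and> card A = k"
  by (auto simp: ksets_def finite_subset)

lemma card_link_del:
  assumes "finite F"
  shows "card F = card (link x F) + card (del x F)"
proof -
  have "A \<in> insert x ` link x F" if "A \<in> F" "x \<in> A" for A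
    using that by (intro image_eqI[of _ _ "A - {x}"]) (auto simp: link_def insert_absorb)
  then have "F = insert x ` link x F \<union> del x F"
    by (auto simp: link_def del_def)
  moreover have "inj_on (insert x) (link x F)"
    by (auto simp: inj_on_def link_def)
  moreover have "insert x ` link x F \<inter> del x F = {}"
    by (auto simp: del_def)
  ultimately show ?thesis
    using assms by (metis card_Un_disjoint card_image finite_Un)
qed

lemma link_ksets:
  assumes "finite V" "F \<subseteq> ksets (insert x V) (Suc k)"
  shows "link x F \<subseteq> ksets V k"
proof
  fix A assume A: "A \<in> link x F"
  then have "insert x A \<in> ksets (insert x V) (Suc k)" "x \<notin> A"
    using assms by (auto simp: link_def)
  then show "A \<in> ksets V k"
    using assms(1) finite_subset[of "insert x A" "insert x V"] by (auto simp: ksets_def)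
qed

lemma del_ksets: "F \<subseteq> ksets (insert x V) k \<Longrightarrow> del x F \<subseteq> ksets V k"
  by (auto simp: del_def ksets_def)

lemma shifted_link:
  assumes "shifted V F" "x \<notin> V"
  shows "shifted V (link x F)"
  unfolding shifted_def
proof (intro ballI impI)
  fix A y z assume A: "A \<in> link x F" and y: "y \<in> A \<inter> V" and z: "z \<in> V - A" "z < y"
  have ne: "y \<noteq> x" "z \<noteq> x" using y z assms(2) by auto
  then have "insert z (insert x A - {y}) \<in> F"
    using assms(1) A y z by (intro shiftedD[of V F "insert x A" y z]) (auto simp: link_def)
  also have "insert z (insert x A - {y}) = insert x (insert z (A - {y}))"
    using ne by auto
  finally show "insert z (A - {y}) \<in> link x F"
    using A ne by (auto simp: link_def)
qed

lemma shifted_del: "shifted V F \<Longrightarrow> x \<notin> V \<Longrightarrow> shifted V (del x F)"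
  unfolding shifted_def del_def by blast

lemma shifted_subset: "shifted V F \<Longrightarrow> V' \<subseteq> V \<Longrightarrow> shifted V' F"
  unfolding shifted_def by blast

text \<open>The largest point \<open>M\<close> of a member can be traded for a point outside a
  prescribed set \<open>X\<close>. For two sets whose only extra common point is \<open>M\<close>,
  this turns an intersection property of the family into the same property of its links.\<close>

lemma shifted_replace_max:
  assumes "shifted (insert M V) F" "\<forall>v\<in>V. v < M"
    "A \<in> link M F" "finite A" "finite X" "card (A \<union> X) < card V"
  obtains z where "z \<in> V" "z \<notin> A" "z \<notin> X" "insert z A \<in> F"
proof -
  have "\<not> V \<subseteq> A \<union> X"
    using assms(4-6) card_mono[of "A \<union> X" V] by auto
  then obtain z where z: "z \<in> V" "z \<notin> A" "z \<notin> X" by auto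
  then have "insert z (insert M A - {M}) \<in> F"
    using assms by (intro shiftedD[OF assms(1), of "insert M A" M z]) (auto simp: link_def)
  then show ?thesis
    using that z assms(3) by (simp add: link_def)
qed

lemma card_le_1_if_inter_full:
  assumes "W \<subseteq> ksets V t" "finite V" "\<And>A B. A \<in> W \<Longrightarrow> B \<in> W \<Longrightarrow> t \<le> card (A \<inter> B)" "A \<in> W" "B \<in> W"
  shows "A = B"
proof -
  have fin: "finite A" "finite B" and c: "card A = t" "card B = t"
    using assms ksets_D by blast+
  have "card (A \<inter> B) = t"
    using assms(3)[OF assms(4,5)] c card_mono[OF fin(1), of "A \<inter> B"] by simp
  then have "A \<inter> B = A" "A \<inter> B = B"
    using fin c by (simp_all add: card_subset_eq)
  then show ?thesis by simp
qed

text \<open>A form of Katona's intersecting shadow theorem, for shifted families.\<close>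

lemma shifted_disjoint_shadow:
  fixes V :: "'a::linorder set"
  assumes "finite V" "W \<subseteq> ksets V (t + s)" "shifted V W"
    "\<And>A B. A \<in> W \<Longrightarrow> B \<in> W \<Longrightarrow> t \<le> card (A \<inter> B)" "t + 2 * s \<le> card V"
  shows "card W \<le> card {v \<in> ksets V s. \<exists>w\<in>W. v \<inter> w = {}}"
  using assms
proof (induction V arbitrary: W s rule: finite_linorder_max_induct)
  case empty
  then have "W \<subseteq> {{}}" "s = 0" by (auto simp: ksets_def)
  then show ?case by (cases "W = {}") (auto simp: subset_singleton_iff)
next
  case (insert M V W s)
  let ?N = "\<lambda>V s W. {v \<in> ksets V s. \<exists>w\<in>W. v \<inter> w = {}}"
  have MV: "M \<notin> V" using insert.hyps by auto
  have finW: "finite W"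
    by (rule finite_subset[OF insert.prems(1)]) (simp add: insert.hyps)
  show ?case
  proof (cases s)
    case 0
    show ?thesis
    proof (cases "W = {}")
      case False
      then obtain w where w: "w \<in> W" by blast
      have "A = w" if "A \<in> W" for A
        by (rule card_le_1_if_inter_full[of W "insert M V" t])
          (use insert.prems(1,3) insert.hyps(1) w 0 that in simp_all)
      then have "W = {w}" using w by blast
      moreover have "?N (insert M V) s {w} = {{}}"
        using 0 insert.hyps by auto
      ultimately show ?thesis by simp
    qed simp
  next
    case (Suc r)
    have cV: "card (insert M V) = Suc (card V)" using MV insert.hyps by simp
    show ?thesis
    proof (cases "card (insert M V) = t + 2 * s")
      case True
      \<comment> \<open>Complements of members have exactly \<open>s\<close> points in this case,
        and each is disjoint from its member.\<close>
      have "(\<lambda>w. insert M V - w) ` W \<subseteq> ?N (insert M V) s W"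
        using insert.prems(1) insert.hyps True
        by (auto simp: ksets_def card_Diff_subset finite_subset)
      moreover have "inj_on (\<lambda>w. insert M V - w) W"
        using insert.prems(1) by (intro inj_onI) (auto simp: ksets_def)
      ultimately show ?thesis
        using insert.hyps by (intro card_inj_on_le[of "\<lambda>w. insert M V - w"]) auto
    next
      case False
      then have big: "t + 2 * s \<le> card V" using insert.prems cV by simp
      have L: "link M W \<subseteq> ksets V (t + r)"
        using insert.prems(1) insert.hyps Suc by (intro link_ksets) auto
      have 1: "card (del M W) \<le> card (?N V s (del M W))"
        using insert.prems(1,3) big MV shifted_subset[OF insert.prems(2), of V]
        by (intro insert.IH del_ksets shifted_del) (auto simp: del_def)
      have 2: "card (link M W) \<le> card (?N V r (link M W))"
      proof (intro insert.IH L shifted_link)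
        show "shifted V W" using insert.prems(2) shifted_subset by blast
        show "t + 2 * r \<le> card V" using big Suc by simp
        fix A B assume AB: "A \<in> link M W" "B \<in> link M W"
        have f: "finite A" "finite B" "card A = t + r" "card B = t + r"
          using AB L ksets_D[OF _ insert.hyps(1)] by blast+
        show "t \<le> card (A \<inter> B)"
        proof -
          have "t \<le> card (insert M A \<inter> insert M B)"
            using AB by (intro insert.prems(3)) (auto simp: link_def)
          also have "insert M A \<inter> insert M B = insert M (A \<inter> B)" by auto
          finally have "t \<le> Suc (card (A \<inter> B))"
            using AB f by (simp add: link_def)
          \<comment> \<open>With at least \<open>t - 1\<close> common points, \<open>A\<close> and
            \<open>B\<close> leave a point \<open>z\<close> of \<open>V\<close> free. With
            \<open>z\<close> in place of \<open>M\<close> in the first set, the two members have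
            exactly \<open>A \<inter> B\<close> in common.\<close>
          then have "card (A \<union> B) < card V"
            using card_Un_Int[OF f(1,2)] f big Suc by simp
          then obtain z where z: "z \<notin> A" "z \<notin> B" "insert z A \<in> W" "z \<in> V"
            using shifted_replace_max[OF insert.prems(2) insert.hyps(2) AB(1) f(1) f(2)] by metis
          have "M \<notin> A" "z \<noteq> M" using AB(1) z MV by (auto simp: link_def)
          then have "insert z A \<inter> insert M B = A \<inter> B" using z by auto
          then show ?thesis
            using insert.prems(3)[of "insert z A" "insert M B"] z AB by (auto simp: link_def)
        qed
      qed (use MV in auto)
      \<comment> \<open>Sets without \<open>M\<close> come from the deletion, sets with
        \<open>M\<close> from the link. If \<open>v\<close> is disjoint from \<open>u\<close> in the
        link, then \<open>insert M v\<close> still meets \<open>insert M u\<close>, so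
        \<open>M\<close> is traded in the latter for a point outside \<open>u\<close> and
        \<open>v\<close>.\<close>
      have sub: "?N V s (del M W) \<union> insert M ` ?N V r (link M W) \<subseteq> ?N (insert M V) s W"
      proof -
        have "insert M v \<in> ?N (insert M V) s W" if v: "v \<in> ksets V r" and u: "u \<in> link M W" "v \<inter> u = {}" for u v
        proof -
          have f: "finite u" "finite v" "card u = t + r" "card v = r" "v \<subseteq> V"
            using v u L ksets_D[OF _ insert.hyps(1)] by blast+
          have "card (u \<union> v) < card V"
            using card_Un_le[of u v] f big Suc by simp
          then obtain z where z: "z \<in> V" "z \<notin> u" "z \<notin> v" "insert z u \<in> W"
            using shifted_replace_max[OF insert.prems(2) insert.hyps(2) u(1) f(1) f(2)] by metis
          have "M \<notin> v" "M \<notin> insert z u" using f(5) z(1) MV u(1) by (auto simp: link_def)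
          then have "insert M v \<inter> insert z u = {}" using u(2) z(3) by blast
          moreover have "insert M v \<in> ksets (insert M V) s"
            using f(2,4,5) MV Suc by (auto simp: ksets_def card_insert_if)
          ultimately show ?thesis using z(4) by blast
        qed
        then show ?thesis by (auto simp: ksets_def del_def)
      qed
      have "card W \<le> card (?N V s (del M W)) + card (?N V r (link M W))"
        using 1 2 card_link_del[OF finW, of M] by simp
      also have "\<dots> = card (?N V s (del M W)) + card (insert M ` ?N V r (link M W))"
        using MV by (subst card_image) (auto simp: inj_on_def ksets_def)
      also have "\<dots> = card (?N V s (del M W) \<union> insert M ` ?N V r (link M W))"
        using MV insert.hyps by (intro card_Un_disjoint[symmetric]) (auto simp: ksets_def)
      also have "\<dots> \<le> card (?N (insert M V) s W)"
        using sub insert.hyps by (intro card_mono) auto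
      finally show ?thesis .
    qed
  qed
qed

section \<open>Cross-intersecting families\<close>

lemma card_ksets_meeting:
  assumes "finite V" "q \<subseteq> V"
  shows "card {u \<in> ksets V b. u \<inter> q \<noteq> {}} + ((card V - card q) choose b) = card V choose b"
proof -
  have "{u \<in> ksets V b. u \<inter> q = {}} = ksets (V - q) b"
    by (auto simp: ksets_def)
  then have "card {u \<in> ksets V b. u \<inter> q = {}} = (card V - card q) choose b"
    using assms by (simp add: card_ksets card_Diff_subset finite_subset)
  moreover have "ksets V b = {u \<in> ksets V b. u \<inter> q \<noteq> {}} \<union> {u \<in> ksets V b. u \<inter> q = {}}"
    by auto
  then have "card (ksets V b) = card {u \<in> ksets V b. u \<inter> q \<noteq> {}} + card {u \<in> ksets V b. u \<inter> q = {}}"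
    using assms(1) by (subst card_Un_disjoint[symmetric]) (auto intro: finite_subset[OF _ finite_ksets])
  ultimately show ?thesis
    using assms(1) by (simp add: card_ksets)
qed

text \<open>A set \<open>p\<close> in \<open>P\<close> that is the complement of some
  \<open>q\<close> in \<open>Q\<close> would be disjoint from \<open>q\<close>; so the complements
  of \<open>Q\<close> are \<open>a\<close>-sets outside \<open>P\<close>.\<close>

lemma card_complementary_le:
  assumes "finite V" "P \<subseteq> ksets V a" "Q \<subseteq> ksets V a" "card V = 2 * a"
    "\<forall>p\<in>P. \<forall>q\<in>Q. p \<inter> q \<noteq> {}"
  shows "card P + card Q \<le> card V choose a"
proof -
  have fin: "finite P" "finite Q"
    using assms(1-3) finite_subset[OF _ finite_ksets] by blast+
  have inj: "inj_on (\<lambda>q. V - q) Q"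
  proof (rule inj_onI)
    fix p q assume "p \<in> Q" "q \<in> Q" "V - p = V - q"
    moreover from this have "p \<subseteq> V" "q \<subseteq> V" using assms(3) by (auto simp: ksets_def)
    ultimately show "p = q" by blast
  qed
  have "card P + card Q = card P + card ((\<lambda>q. V - q) ` Q)"
    by (simp add: card_image[OF inj])
  also have "\<dots> = card (P \<union> (\<lambda>q. V - q) ` Q)"
    using fin assms(5) by (intro card_Un_disjoint[symmetric]) auto
  also have "\<dots> \<le> card (ksets V a)"
    using assms by (intro card_mono) (auto simp: ksets_def card_Diff_subset finite_subset)
  finally show ?thesis using assms(1) by (simp add: card_ksets)
qed

text \<open>By Pascal's rule the two binomials differ by \<open>(m - Suc (Suc c)) choose c\<close>,
  which is positive, and at least 2 for positive \<open>c\<close>. This gain absorbs the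
  \<open>+ 1\<close> in the bound for two nonempty links.\<close>

lemma choose_pred_bound:
  assumes "2 * Suc (Suc c) \<le> m"
  shows "((m - Suc (Suc c)) choose Suc c) + 1 \<le> ((m - Suc c) choose Suc c)"
    and "0 < c \<Longrightarrow> ((m - Suc (Suc c)) choose Suc c) + 1 < ((m - Suc c) choose Suc c)"
proof -
  define r where "r = m - Suc (Suc c)"
  have r: "m - Suc c = Suc r" "Suc (Suc c) \<le> r" using assms by (auto simp: r_def)
  have "1 \<le> r choose c" using r by (simp add: Suc_le_eq)
  then show "((m - Suc (Suc c)) choose Suc c) + 1 \<le> ((m - Suc c) choose Suc c)"
    unfolding r_def[symmetric] r by simp
  assume "0 < c"
  then obtain d where d: "c = Suc d" by (cases c) auto
  obtain r' where r': "r = Suc r'" using r(2) by (cases r) auto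
  have "0 < r' choose d" "0 < r' choose Suc d" using r(2) d r' by simp_all
  then have "1 < r choose c" unfolding r' d by (simp only: binomial_Suc_Suc)
  then show "((m - Suc (Suc c)) choose Suc c) + 1 < ((m - Suc c) choose Suc c)"
    unfolding r_def[symmetric] r by simp
qed

text \<open>The bound is that of a single \<open>a\<close>-set \<open>q\<close> paired with all
  \<open>a\<close>-sets meeting \<open>q\<close>. The induction removes the largest point
  \<open>M\<close>: the deletions satisfy the bound over \<open>V\<close>, and by Pascal's rule it
  remains to show that the links together have at most as many members as there are
  \<open>(a - 1)\<close>-sets meeting a fixed \<open>a\<close>-set.\<close>

lemma shifted_cross_intersecting:
  fixes V :: "'a::linorder set"
  assumes "finite V" "P \<subseteq> ksets V a" "Q \<subseteq> ksets V a" "shifted V P" "shifted V Q"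
    "P \<noteq> {}" "Q \<noteq> {}" "\<forall>p\<in>P. \<forall>q\<in>Q. p \<inter> q \<noteq> {}" "2 * a \<le> card V"
  shows "card P + card Q + ((card V - a) choose a) \<le> (card V choose a) + 1 \<and>
    (2 * a < card V \<and> 2 \<le> a \<and> card P + card Q + ((card V - a) choose a) = (card V choose a) + 1 \<longrightarrow>
      card P = 1 \<or> card Q = 1 \<or> (a = 2 \<and> (\<exists>y. \<forall>A\<in>P \<union> Q. y \<in> A)))"
  using assms
proof (induction V arbitrary: P Q a rule: finite_linorder_max_induct)
  case empty
  then show ?case by (auto simp: ksets_def)
next
  case (insert M V P Q a)
  note hyps = insert.hyps and IH = insert.IH
  note prems = insert.prems
  have MV: "M \<notin> V" using hyps by auto
  have cV: "card (insert M V) = Suc (card V)" using MV hyps by simp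
  obtain b where a: "a = Suc b"
    using prems(1,2,5,6,7) hyps by (cases a) auto
  have fin: "finite P" "finite Q"
    using prems(1,2) hyps finite_subset[OF _ finite_ksets[of "insert M V"]] by auto
  show ?case
  proof (cases "card (insert M V) = 2 * a")
    case True
    \<comment> \<open>Here \<open>(2 * a - a) choose a\<close> is 1, which cancels the
      \<open>+ 1\<close>, and the equality clause is vacuous.\<close>
    then show ?thesis
      using card_complementary_le[of "insert M V" P a Q] prems hyps by simp
  next
    case False
    then have big: "2 * a \<le> card V" using prems(8) cV by simp
    have dk: "del M P \<subseteq> ksets V a" "del M Q \<subseteq> ksets V a"
      using del_ksets[OF prems(1)] del_ksets[OF prems(2)] by simp_all
    have lk: "link M P \<subseteq> ksets V b" "link M Q \<subseteq> ksets V b"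
      using link_ksets[OF hyps(1), of P M b] link_ksets[OF hyps(1), of Q M b] prems(1,2) a by simp_all
    have sh: "shifted V P" "shifted V Q"
      using shifted_subset[OF prems(3)] shifted_subset[OF prems(4)] by (simp_all add: subset_insertI)
    have del_ne: "del M R \<noteq> {}" if R: "R \<subseteq> ksets (insert M V) a" "shifted (insert M V) R" "R \<noteq> {}" for R
    proof -
      obtain A where A: "A \<in> R" using R by blast
      show ?thesis
      proof (cases "M \<in> A")
        case True
        then have l: "A - {M} \<in> link M R" using A by (simp add: link_def insert_absorb)
        have f: "finite A" "card A = a" using A R(1) hyps(1) ksets_D[of A "insert M V" a] by blast+
        have "card (A - {M} \<union> {}) < card V" using f True big a by simp
        then obtain z where "z \<in> V" "insert z (A - {M}) \<in> R"
          using shifted_replace_max[OF R(2) hyps(2) l, of "{}"] f by auto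
        then show ?thesis using MV by (auto simp: del_def)
      qed (use A in \<open>auto simp: del_def\<close>)
    qed
    have ne: "del M P \<noteq> {}" "del M Q \<noteq> {}" using del_ne[OF prems(1,3,5)] del_ne[OF prems(2,4,6)] by simp_all
    have bound0: "card (del M P) + card (del M Q) + ((card V - a) choose a) \<le> (card V choose a) + 1"
      using IH[OF dk shifted_del[OF sh(1) MV] shifted_del[OF sh(2) MV] ne _ big] prems(7)
      unfolding del_def by blast
    have cross: "u \<inter> v \<noteq> {}" if uv: "u \<in> link M P" "v \<in> link M Q" for u v
    proof -
      have f: "finite u" "finite v" "card u = b" "card v = b"
        using ksets_D[OF _ hyps(1)] subsetD[OF lk(1) uv(1)] subsetD[OF lk(2) uv(2)] by blast+
      have "card (u \<union> v) < card V" using card_Un_le[of u v] f a big by simp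
      then obtain z where z: "z \<in> V" "z \<notin> u" "z \<notin> v" "insert z u \<in> P"
        using shifted_replace_max[OF prems(3) hyps(2) uv(1) f(1,2)] by metis
      have "insert M v \<in> Q" using uv by (simp add: link_def)
      then have "insert z u \<inter> insert M v \<noteq> {}" by (rule bspec[OF bspec[OF prems(7) z(4)]])
      then show ?thesis using z MV uv by (auto simp: link_def)
    qed
    have meet: "card R \<le> card {u \<in> ksets V b. u \<inter> q \<noteq> {}}"
      "card {u \<in> ksets V b. u \<inter> q \<noteq> {}} + ((card V - a) choose b) = card V choose b"
      if "R \<subseteq> ksets V b" "\<forall>u\<in>R. u \<inter> q \<noteq> {}" "q \<in> ksets V a" for R q
    proof -
      show "card R \<le> card {u \<in> ksets V b. u \<inter> q \<noteq> {}}"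
        using that(1,2) hyps(1) by (intro card_mono) (auto intro: finite_subset[OF _ finite_ksets])
      show "card {u \<in> ksets V b. u \<inter> q \<noteq> {}} + ((card V - a) choose b) = card V choose b"
        using card_ksets_meeting[OF hyps(1), of q b] that(3) by (simp add: ksets_def)
    qed
    have linkmeet: "u \<inter> q \<noteq> {}" if "u \<in> link M R" "q \<in> del M R'" "\<forall>p\<in>R. \<forall>q\<in>R'. p \<inter> q \<noteq> {}" for u q R R'
    proof -
      have "insert M u \<in> R" "q \<in> R'" "M \<notin> q" using that by (auto simp: link_def del_def)
      then have "insert M u \<inter> q \<noteq> {}" "M \<notin> q" using that(3) by blast+
      then show ?thesis by blast
    qed
    have crossPQ: "\<forall>p\<in>P. \<forall>q\<in>Q. p \<inter> q \<noteq> {}" and crossQP: "\<forall>p\<in>Q. \<forall>q\<in>P. p \<inter> q \<noteq> {}"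
      using prems(7) by blast+
    \<comment> \<open>A member \<open>q\<close> of \<open>R'\<close> without \<open>M\<close> must
      meet every set in the link of \<open>R\<close>. In case of equality the link consists of all
      \<open>b\<close>-sets meeting \<open>q\<close>, whichever such \<open>q\<close> is chosen. For
      positive \<open>b\<close> a \<open>b\<close>-set through a point of \<open>q' - q\<close> that
      avoids \<open>q\<close> shows that there is only one choice.\<close>
    have one: "card (link M R) + ((card V - a) choose b) \<le> card V choose b \<and>
        (card (link M R) + ((card V - a) choose b) = card V choose b \<and> link M R' = {} \<and> 0 < b \<longrightarrow> card R' = 1)"
      if R: "link M R \<subseteq> ksets V b" "\<forall>p\<in>R. \<forall>q\<in>R'. p \<inter> q \<noteq> {}" "del M R' \<subseteq> ksets V a" "del M R' \<noteq> {}" for R R'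
    proof (intro conjI impI)
      obtain q where q: "q \<in> del M R'" using R(4) by blast
      show "card (link M R) + ((card V - a) choose b) \<le> card V choose b"
        using meet[OF R(1), of q] linkmeet[OF _ q R(2)] q R(3) by auto
      assume as: "card (link M R) + ((card V - a) choose b) = card V choose b \<and> link M R' = {} \<and> 0 < b"
      have all: "link M R = {u \<in> ksets V b. u \<inter> q \<noteq> {}}" if q: "q \<in> del M R'" for q
        using meet[OF R(1), of q] linkmeet[OF _ q R(2)] q R(1,3) as hyps(1)
        by (intro card_subset_eq) auto
      have "q' = q" if q': "q' \<in> del M R'" for q'
      proof (rule ccontr)
        assume "q' \<noteq> q"
        have f: "card q = a" "card q' = a" "q \<subseteq> V" "q' \<subseteq> V" "finite q" "finite q'"
          using q q' R(3) ksets_D[OF _ hyps(1)] by blast+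
        have "\<not> q' \<subseteq> q"
          using card_subset_eq[OF f(5)] f \<open>q' \<noteq> q\<close> by auto
        then obtain y where y: "y \<in> q'" "y \<notin> q" by blast
        have "b \<le> card (V - q)" using f big a hyps(1) by (simp add: card_Diff_subset)
        then show False
        proof -
          have "\<exists>u. {y} \<subseteq> u \<and> u \<subseteq> V - q \<and> card u = b"
            using y f hyps(1) as \<open>b \<le> card (V - q)\<close> by (intro exists_subset_between) auto
          then obtain u where u: "y \<in> u" "u \<subseteq> V - q" "card u = b" by auto
          then have "u \<in> {u \<in> ksets V b. u \<inter> q' \<noteq> {}}" "u \<notin> {u \<in> ksets V b. u \<inter> q \<noteq> {}}"
            using y by (auto simp: ksets_def)
          then show False using all[OF q] all[OF q'] by blast
        qed
      qed
      then have "del M R' = {q}" using q by blast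
      moreover have "R' = del M R'"
      proof -
        have "A - {M} \<in> link M R'" if "A \<in> R'" "M \<in> A" for A
          using that by (simp add: link_def insert_absorb)
        then show ?thesis using as by (auto simp: del_def)
      qed
      ultimately show "card R' = 1" by simp
    qed
    have oneP: "card (link M P) + ((card V - a) choose b) \<le> card V choose b \<and>
        (card (link M P) + ((card V - a) choose b) = card V choose b \<and> link M Q = {} \<and> 0 < b \<longrightarrow> card Q = 1)"
      by (rule one[OF lk(1) crossPQ dk(2) ne(2)])
    have oneQ: "card (link M Q) + ((card V - a) choose b) \<le> card V choose b \<and>
        (card (link M Q) + ((card V - a) choose b) = card V choose b \<and> link M P = {} \<and> 0 < b \<longrightarrow> card P = 1)"
      by (rule one[OF lk(2) crossQP dk(1) ne(1)])
    have link2: "card (link M P) + card (link M Q) + ((card V - b) choose b) \<le> (card V choose b) + 1"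
      if "link M P \<noteq> {}" "link M Q \<noteq> {}"
      using IH[OF lk shifted_link[OF sh(1) MV] shifted_link[OF sh(2) MV] that] cross big a by auto
    have bpos: "\<exists>c. b = Suc c" if "link M P \<noteq> {}" "link M Q \<noteq> {}"
      using that cross lk hyps(1) by (cases b) auto
    have step: "card (link M P) + card (link M Q) + ((card V - a) choose b) \<le> card V choose b"
    proof (cases "link M P = {} \<or> link M Q = {}")
      case True
      then show ?thesis using oneP oneQ by auto
    next
      case False
      then obtain c where c: "b = Suc c" using bpos by blast
      show ?thesis using link2 False choose_pred_bound(1)[of c "card V"] big a c by auto
    qed
    have pas: "Suc (card V) choose a = (card V choose b) + (card V choose a)"
      "(Suc (card V) - a) choose a = ((card V - a) choose b) + ((card V - a) choose a)"
    proof -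
      show "Suc (card V) choose a = (card V choose b) + (card V choose a)"
        unfolding a by simp
      have "Suc (card V) - a = Suc (card V - a)"
        using big by simp
      then show "(Suc (card V) - a) choose a = ((card V - a) choose b) + ((card V - a) choose a)"
        unfolding a by (simp only: binomial_Suc_Suc)
    qed
    have split: "card P = card (link M P) + card (del M P)" "card Q = card (link M Q) + card (del M Q)"
      by (rule card_link_del[OF fin(1)] card_link_del[OF fin(2)])+
    show ?thesis unfolding cV
    proof (intro conjI impI)
      show "card P + card Q + ((Suc (card V) - a) choose a) \<le> (Suc (card V) choose a) + 1"
        using step bound0 pas split by linarith
      assume eq: "2 * a < Suc (card V) \<and> 2 \<le> a \<and>
        card P + card Q + ((Suc (card V) - a) choose a) = (Suc (card V) choose a) + 1"
      then have stepeq: "card (link M P) + card (link M Q) + ((card V - a) choose b) = card V choose b"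
        using step bound0 pas split by linarith
      show "card P = 1 \<or> card Q = 1 \<or> (a = 2 \<and> (\<exists>y. \<forall>A\<in>P \<union> Q. y \<in> A))"
      proof (cases "link M P = {} \<or> link M Q = {}")
        case True
        then show ?thesis
          using oneP oneQ stepeq eq a by auto
      next
        case False
        then obtain c where c: "b = Suc c" using bpos by blast
        \<comment> \<open>For positive \<open>c\<close> the gain from Pascal's rule exceeds the
          \<open>+ 1\<close>, so two nonempty links could not reach equality. Hence the links
          consist of singletons, and cross-intersection makes them all the same
          \<open>{y}\<close>.\<close>
        have "c = 0"
          using link2 False choose_pred_bound(2)[of c "card V"] big a c stepeq by fastforce
        then have b1: "b = 1" "a = 2" using a c by auto
        have single: "\<exists>y\<in>V. u = {y}" if "u \<in> link M P \<union> link M Q" for u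
          using that lk b1 by (auto simp: ksets_def card_1_singleton_iff)
        obtain u v where uv: "u \<in> link M P" "v \<in> link M Q" using False by blast
        obtain y where y: "y \<in> V" "u = {y}" using single uv by blast
        have "v = {y}" using single[of v] uv cross[OF uv] y by auto
        then have yM: "{y} \<in> link M P" "{y} \<in> link M Q" using uv y by auto
        \<comment> \<open>Trading \<open>M\<close> in \<open>{y, M}\<close> puts all pairs
          \<open>{y, z}\<close> into both families. A pair avoiding \<open>y\<close> would have to
          contain all of \<open>V - {y}\<close>, which has at least three points.\<close>
        have star: "{y, z} \<in> R" if "{y} \<in> link M R" "shifted (insert M V) R" "z \<in> V" "z \<noteq> y" for R z
        proof -
          have "insert z (insert M {y} - {M}) \<in> R"
            using that hyps(2) y MV by (intro shiftedD[OF that(2)]) (auto simp: link_def)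
          also have "insert z (insert M {y} - {M}) = {y, z}"
            using y MV by auto
          finally show ?thesis .
        qed
        have inA: "y \<in> A" if A: "A \<in> ksets (insert M V) a" and meets: "\<forall>z\<in>V - {y}. A \<inter> {y, z} \<noteq> {}" for A
        proof (rule ccontr)
          assume "y \<notin> A"
          then have "V - {y} \<subseteq> A" using meets by auto
          then have "card (V - {y}) \<le> 2"
            using A b1 hyps(1) card_mono[of A "V - {y}"] ksets_D[OF A] by auto
          then show False using big b1 y hyps(1) by simp
        qed
        have "y \<in> A" if "A \<in> P" for A
        proof (rule inA[OF subsetD[OF prems(1) that]], rule ballI)
          fix z assume "z \<in> V - {y}"
          then have "{y, z} \<in> Q" using star[OF yM(2) prems(4)] by simp
          then show "A \<inter> {y, z} \<noteq> {}" by (rule bspec[OF bspec[OF crossPQ that]])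
        qed
        moreover have "y \<in> A" if "A \<in> Q" for A
        proof (rule inA[OF subsetD[OF prems(2) that]], rule ballI)
          fix z assume "z \<in> V - {y}"
          then have "{y, z} \<in> P" using star[OF yM(1) prems(3)] by simp
          then show "A \<inter> {y, z} \<noteq> {}" by (rule bspec[OF bspec[OF crossQP that]])
        qed
        ultimately have "\<forall>A\<in>P \<union> Q. y \<in> A" by blast
        then show ?thesis using b1 by blast
      qed
    qed
  qed
qed

section \<open>Partitions into two cross-intersecting families\<close>

text \<open>The exchange graph on the \<open>r\<close>-subsets of \<open>V\<close> is connected:
  exchanging a point of \<open>s - t\<close> for one of \<open>t - s\<close> decreases
  \<open>card (t - s)\<close>.\<close>

lemma ksets_swap_closed:
  assumes "finite V" "s \<in> ksets V r" "t \<in> ksets V r" "R s"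
    and swap: "\<And>s y z. s \<in> ksets V r \<Longrightarrow> R s \<Longrightarrow> y \<in> s \<Longrightarrow> z \<in> V - s \<Longrightarrow> R (insert z (s - {y}))"
  shows "R t"
  using assms(2,4)
proof (induction "card (t - s)" arbitrary: s)
  case 0
  have "finite t" "finite s" "card t = r" "card s = r"
    using ksets_D[OF assms(3,1)] ksets_D[OF 0(2) assms(1)] by auto
  moreover from this have "t \<subseteq> s" using 0(1) by simp
  ultimately have "t = s" by (simp add: card_subset_eq)
  then show ?case using 0 by simp
next
  case (Suc m)
  have f: "finite t" "finite s" "card t = r" "card s = r" "t \<subseteq> V" "s \<subseteq> V"
    using ksets_D[OF assms(3,1)] ksets_D[OF Suc(3) assms(1)] by auto
  have "t - s \<noteq> {}" using Suc(2) by (metis card.empty nat.distinct(1))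
  then obtain z where z: "z \<in> t" "z \<notin> s" by blast
  have "\<not> s \<subseteq> t" using card_subset_eq[OF f(1), of s] f z by auto
  then obtain y where y: "y \<in> s" "y \<notin> t" by blast
  have "t - insert z (s - {y}) = (t - s) - {z}" using y by auto
  then have "m = card (t - insert z (s - {y}))" using Suc(2) z f by simp
  moreover have "insert z (s - {y}) \<in> ksets V r"
    using f y z card_Suc_Diff1[OF f(2) y(1)] by (auto simp: ksets_def)
  ultimately show ?case
    using Suc(1) swap[OF Suc(3,4) y(1)] z f(5) by blast
qed

lemma ksets_exists_avoiding:
  assumes "finite V" "finite X" "m + card X \<le> card V"
  obtains s where "s \<in> ksets V m" "s \<inter> X = {}"
proof -
  have "m \<le> card (V - X)"
    using diff_card_le_card_Diff[OF assms(2), of V] assms(3) by linarith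
  then obtain s where "s \<subseteq> V - X" "card s = m"
    using obtain_subset_with_card_n by metis
  then show ?thesis using that[of s] by (auto simp: ksets_def)
qed

text \<open>Disjoint sets lie on the same side of the partition into \<open>P\<close> and \<open>Q\<close>. So all sets
  separating two given points of \<open>C\<close> lie on one side, and this side does not depend on the points.\<close>

lemma cross_intersecting_partition:
  assumes fin: "finite V" and big: "2 * m + 1 \<le> card V" and m: "2 \<le> m"
    and C: "C \<subseteq> V" "m \<le> card C"
    and un: "P \<union> Q = {u \<in> ksets V m. u \<inter> C \<noteq> {}}" and int: "P \<inter> Q \<subseteq> {C}"
    and cross: "\<forall>p\<in>P. \<forall>q\<in>Q. p \<inter> q \<noteq> {}"
  shows "P \<subseteq> {C} \<or> Q \<subseteq> {C}"
proof -
  \<comment> \<open>\<open>insert c' s'\<close> meets \<open>C\<close>, so it lies in one of the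
    families; being disjoint from a member of \<open>P\<close>, it cannot lie in
    \<open>Q\<close>.\<close>
  have step: "insert c' s' \<in> P"
    if "insert c s \<in> P" "c \<in> C" "c' \<in> C" "c \<noteq> c'" "s \<in> ksets (V - {c, c'}) (m - 1)"
      "s' \<in> ksets (V - {c, c'}) (m - 1)" "s \<inter> s' = {}" for c c' s s'
  proof -
    have s': "s' \<subseteq> V - {c, c'}" "card s' = m - 1" "finite s'"
      using that(6) fin ksets_D by blast+
    have s: "s \<subseteq> V - {c, c'}" using that(5) by (auto simp: ksets_def)
    have "insert c' s' \<in> ksets V m"
      using s' that(3) C(1) m by (auto simp: ksets_def card_insert_if)
    then have "insert c' s' \<in> P \<union> Q" using that(3) unfolding un by blast
    moreover have "insert c s \<inter> insert c' s' = {}" using s s' that(4,7) by blast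
    then have "insert c' s' \<notin> Q" using cross that(1) by blast
    ultimately show ?thesis by blast
  qed
  have all1: "insert c t \<in> P"
    if c: "c \<in> C" "c' \<in> C" "c \<noteq> c'" and s: "insert c s \<in> P" "s \<in> ksets (V - {c, c'}) (m - 1)"
      and t: "t \<in> ksets (V - {c, c'}) (m - 1)" for c c' s t
  proof (rule ksets_swap_closed[where R = "\<lambda>s. insert c s \<in> P", OF _ s(2) t s(1)])
    have cV: "card (V - {c, c'}) = card V - 2" using c C(1) by (simp add: card_Diff_subset subsetD)
    show "finite (V - {c, c'})" using fin by simp
    fix r y z assume r: "r \<in> ksets (V - {c, c'}) (m - 1)" "insert c r \<in> P" "y \<in> r" "z \<in> V - {c, c'} - r"
    have fr: "finite r" "card r = m - 1" "r \<subseteq> V - {c, c'}" using r(1) fin ksets_D by blast+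
    \<comment> \<open>A single exchange is made of two moves between disjoint sets, via
      \<open>insert c' s'\<close>. The choice of \<open>s'\<close> takes \<open>(m - 1) + m\<close>
      points of \<open>V - {c, c'}\<close>, which is exactly what
      \<open>2 * m + 1 \<le> card V\<close> provides.\<close>
    obtain s' where s': "s' \<in> ksets (V - {c, c'}) (m - 1)" "s' \<inter> insert z r = {}"
      by (rule ksets_exists_avoiding[of "V - {c, c'}" "insert z r" "m - 1"])
        (use fin fr r(4) cV big m in auto)
    have "insert c' s' \<in> P"
      using step[OF r(2) c(1,2,3) r(1) s'(1)] s'(2) by blast
    moreover have comm: "V - {c, c'} = V - {c', c}" by blast
    moreover have "insert z (r - {y}) \<in> ksets (V - {c', c}) (m - 1)"
      using fr r(3,4) card_Suc_Diff1[OF fr(1) r(3)] by (auto simp: ksets_def)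
    ultimately show "insert c (insert z (r - {y})) \<in> P"
      using step[of c' s' c "insert z (r - {y})"] c s' by auto
  qed
  \<comment> \<open>If \<open>v\<close> contains \<open>c\<close>, then \<open>all1\<close> applies;
    if it contains \<open>c'\<close> instead, it is reached from a set in \<open>P\<close> that
    contains \<open>c\<close> and is disjoint from it.\<close>
  have sep: "v \<in> P"
    if c: "c \<in> C" "c' \<in> C" "c \<noteq> c'" and u: "u \<in> P" "c \<in> u" "c' \<notin> u"
      and v: "v \<in> ksets V m" "(c \<in> v) \<noteq> (c' \<in> v)" for c c' u v
  proof -
    have part: "w - {x} \<in> ksets (V - {c, c'}) (m - 1)"
      if "w \<in> ksets V m" "x \<in> w" "{x, y} = {c, c'}" "y \<notin> w" for w x y
      using that by (auto simp: ksets_def card_Diff_singleton)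
    have uk: "u \<in> ksets V m" using u(1) un by blast
    have us: "insert c (u - {c}) \<in> P" using u by (simp add: insert_absorb)
    have usk: "u - {c} \<in> ksets (V - {c, c'}) (m - 1)" using part[OF uk u(2) _ u(3)] by blast
    show ?thesis
    proof (cases "c \<in> v")
      case True
      then have "v - {c} \<in> ksets (V - {c, c'}) (m - 1)" using part[OF v(1), of c c'] v(2) by blast
      then show ?thesis using all1[OF c us usk] True by (metis insert_Diff)
    next
      case False
      then have c'v: "c' \<in> v" using v(2) by blast
      then have vk: "v - {c'} \<in> ksets (V - {c, c'}) (m - 1)" using part[OF v(1), of c' c] False by blast
      obtain s where s: "s \<in> ksets (V - {c, c'}) (m - 1)" "s \<inter> (v - {c'}) = {}"
        by (rule ksets_exists_avoiding[of "V - {c, c'}" "v - {c'}" "m - 1"])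
          (use fin vk ksets_D[OF vk] c C(1) big in \<open>auto simp: card_Diff_subset subsetD\<close>)
      have "insert c' (v - {c'}) \<in> P"
        using step[OF all1[OF c us usk s(1)] c s(1) vk s(2)] .
      then show ?thesis using c'v by (simp add: insert_absorb)
    qed
  qed
  have split: "\<exists>c c'. c \<in> C \<and> c' \<in> C \<and> c \<in> u \<and> c' \<notin> u" if "u \<in> P \<union> Q" "u \<noteq> C" for u
  proof -
    have u: "finite u" "card u = m" "u \<inter> C \<noteq> {}"
      using that(1) ksets_D[of u V m] fin unfolding un by blast+
    have "\<not> C \<subseteq> u"
    proof
      assume "C \<subseteq> u"
      then have "card C = card u" using u C(2) card_mono[of u C] by simp
      then show False using card_subset_eq[OF u(1) \<open>C \<subseteq> u\<close>] that(2) by simp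
    qed
    then show ?thesis using u(3) by blast
  qed
  show ?thesis
  proof (rule ccontr)
    assume "\<not> ?thesis"
    then obtain u v where uv: "u \<in> P" "u \<noteq> C" "v \<in> Q" "v \<noteq> C" by blast
    obtain c c' where c: "c \<in> C" "c' \<in> C" "c \<in> u" "c' \<notin> u" using split uv by blast
    obtain d d' where d: "d \<in> C" "d' \<in> C" "d \<in> v" "d' \<notin> v" using split uv by blast
    have vP: "v \<notin> P" using uv int by blast
    have vk: "v \<in> ksets V m" using uv un by blast
    have cc': "c \<noteq> c'" using c by blast
    have same: "(c \<in> v) = (c' \<in> v)" using sep[OF c(1,2) cc' uv(1) c(3,4) vk] vP by blast
    \<comment> \<open>\<open>v\<close> contains one point of \<open>C\<close> and misses another,
      but does not separate \<open>c\<close> from \<open>c'\<close>; so it separates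
      \<open>c\<close> from a third point \<open>e\<close> of \<open>C\<close>. The set
      \<open>insert c s\<close> below separates \<open>c\<close> from both \<open>c'\<close> and
      \<open>e\<close>, and thus carries membership in \<open>P\<close> from \<open>u\<close> to
      \<open>v\<close>.\<close>
    obtain e where e: "e \<in> C" "e \<noteq> c" "e \<noteq> c'" "(c \<in> v) \<noteq> (e \<in> v)"
    proof (cases "c \<in> v")
      case True
      then show ?thesis using that[of d'] d same by blast
    next
      case False
      then show ?thesis using that[of d] d same by blast
    qed
    obtain s where s: "s \<in> ksets V (m - 1)" "s \<inter> {c, c', e} = {}"
      by (rule ksets_exists_avoiding[of V "{c, c', e}" "m - 1"]) (use fin big m in \<open>auto simp: card_insert_if\<close>)
    have w: "insert c s \<in> ksets V m"
      using s c(1) C(1) m ksets_D[OF s(1) fin] by (auto simp: ksets_def)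
    have "insert c s \<in> P"
      using sep[OF c(1,2) cc' uv(1) c(3,4) w] s(2) cc' by blast
    then have "v \<in> P"
      using sep[OF c(1) e(1) e(2)[symmetric] _ _ _ vk e(4), of "insert c s"] s(2) e(2) by blast
    then show False using vP by blast
  qed
qed

section \<open>The Hilton--Milner theorem\<close>

definition intersecting :: "'a set set \<Rightarrow> bool" where
  "intersecting F \<longleftrightarrow> (\<forall>A\<in>F. \<forall>B\<in>F. A \<inter> B \<noteq> {})"

lemma intersectingD: "intersecting F \<Longrightarrow> A \<in> F \<Longrightarrow> B \<in> F \<Longrightarrow> A \<inter> B \<noteq> {}"
  by (auto simp: intersecting_def)

text \<open>The two shapes of the families attaining the Hilton--Milner bound, which \<open>hm_large\<close> states
  without truncated subtraction of binomial coefficients.\<close>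

definition hm_type :: "'a set \<Rightarrow> nat \<Rightarrow> 'a set set \<Rightarrow> bool" where
  "hm_type V k F \<longleftrightarrow> (\<exists>x\<in>V. card (del x F) = 1) \<or>
    (k = 3 \<and> (\<exists>D\<subseteq>V. card D = 3 \<and> (\<forall>A\<in>F. 2 \<le> card (A \<inter> D))))"

definition hm_large :: "'a set \<Rightarrow> nat \<Rightarrow> 'a set set \<Rightarrow> bool" where
  "hm_large V k F \<longleftrightarrow>
    (card V - 1 choose (k - 1)) + 1 \<le> card F + (card V - k - 1 choose (k - 1))"

text \<open>\<open>F\<close> is counted by the trace on \<open>{i, j}\<close>. Members of
  \<open>?W\<close> share two points, so at least \<open>card ?W\<close> sets are disjoint from some
  member of \<open>?W\<close>, and none of these is in \<open>?R\<close>; hence \<open>?R\<close>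
  and \<open>?W\<close> together have at most \<open>card U choose (k - 2)\<close> members. Added to
  the cross-intersecting bound for \<open>?P\<close> and \<open>?Q\<close>, this is the
  Hilton--Milner bound, so the equality cases of the cross-intersecting bound apply.\<close>

lemma hm_type_if_shifted:
  fixes U :: "'a::linorder set"
  assumes U: "finite U" "i \<notin> U" "j \<notin> U" "i \<noteq> j" and V: "V = insert i (insert j U)"
    and F: "F \<subseteq> ksets V k" "intersecting F" "shifted U F" "hm_large V k F"
    and k: "3 \<le> k" "2 * k < card V"
    and ne: "link i (del j F) \<noteq> {}" "link j (del i F) \<noteq> {}"
    and two: "\<And>A B. A \<in> del i (del j F) \<Longrightarrow> B \<in> del i (del j F) \<Longrightarrow> 2 \<le> card (A \<inter> B)"
    and down: "\<And>w z. w \<in> del i (del j F) \<Longrightarrow> z \<in> w \<Longrightarrow>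
      insert i (w - {z}) \<in> F \<and> insert j (w - {z}) \<in> F"
  shows "hm_type V k F"
proof -
  let ?P = "link i (del j F)" and ?Q = "link j (del i F)"
  let ?W = "del i (del j F)" and ?R = "link i (link j F)"
  obtain s where s: "k = Suc (Suc s)" "1 \<le> s" using k(1) by (cases k rule: nat.exhaust; cases "k - 1") auto
  have V': "V = insert j (insert i U)" using V by blast
  have cV: "card V = card U + 2" using U V by simp
  have finV: "finite V" using U V by simp
  have finF: "finite F" by (rule finite_subset[OF F(1) finite_ksets[OF finV]])
  have dj: "del j F \<subseteq> ksets (insert i U) k" by (rule del_ksets) (use F(1) V' in simp)
  have di: "del i F \<subseteq> ksets (insert j U) k" by (rule del_ksets) (use F(1) V in simp)
  have lj: "link j F \<subseteq> ksets (insert i U) (Suc s)"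
    by (rule link_ksets) (use U F(1) V' s in auto)
  have P: "?P \<subseteq> ksets U (Suc s)" by (rule link_ksets[OF U(1)]) (use dj s in simp)
  have Q: "?Q \<subseteq> ksets U (Suc s)" by (rule link_ksets[OF U(1)]) (use di s in simp)
  have W: "?W \<subseteq> ksets U k" by (rule del_ksets[OF dj])
  have R: "?R \<subseteq> ksets U s" by (rule link_ksets[OF U(1) lj])
  have mem: "insert i p \<in> F" "i \<notin> p" "j \<notin> p" if "p \<in> ?P" for p
    using that by (auto simp: link_def del_def)
  have memQ: "insert j p \<in> F" "i \<notin> p" "j \<notin> p" if "p \<in> ?Q" for p
    using that by (auto simp: link_def del_def)
  have cross: "\<forall>p\<in>?P. \<forall>q\<in>?Q. p \<inter> q \<noteq> {}"
  proof (intro ballI)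
    fix p q assume pq: "p \<in> ?P" "q \<in> ?Q"
    have "insert i p \<inter> insert j q \<noteq> {}"
      using intersectingD[OF F(2)] mem(1) memQ(1) pq by blast
    then show "p \<inter> q \<noteq> {}" using mem[OF pq(1)] memQ[OF pq(2)] U(4) by blast
  qed
  let ?c = "(card U - Suc s) choose Suc s"
  have cr: "card ?P + card ?Q + ?c \<le> (card U choose Suc s) + 1 \<and>
    (2 * Suc s < card U \<and> 2 \<le> Suc s \<and> card ?P + card ?Q + ?c = (card U choose Suc s) + 1 \<longrightarrow>
      card ?P = 1 \<or> card ?Q = 1 \<or> (Suc s = 2 \<and> (\<exists>y. \<forall>A\<in>?P \<union> ?Q. y \<in> A)))"
    by (rule shifted_cross_intersecting[OF U(1) P Q _ _ ne cross])
      (use k cV s F(3) U in \<open>auto intro!: shifted_link shifted_del\<close>)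
  \<comment> \<open>With \<open>t = 2\<close> the members have \<open>k = 2 + s\<close> points, and
    the size condition reads \<open>2 * k - 2 \<le> card U\<close>.\<close>
  have "card ?W \<le> card {v \<in> ksets U s. \<exists>w\<in>?W. v \<inter> w = {}}"
    by (rule shifted_disjoint_shadow[where t = 2])
      (use U W F(3) two k cV s in \<open>auto intro!: shifted_link shifted_del\<close>)
  moreover have "?R \<inter> {v \<in> ksets U s. \<exists>w\<in>?W. v \<inter> w = {}} = {}"
  proof -
    have "r \<inter> w \<noteq> {}" if "r \<in> ?R" "w \<in> ?W" for r w
    proof -
      have "insert j (insert i r) \<in> F" "w \<in> F" "i \<notin> w" "j \<notin> w"
        using that by (auto simp: link_def del_def)
      moreover from this have "insert j (insert i r) \<inter> w \<noteq> {}" using intersectingD[OF F(2)] by blast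
      ultimately show ?thesis by blast
    qed
    then show ?thesis by blast
  qed
  then have "card ?R + card {v \<in> ksets U s. \<exists>w\<in>?W. v \<inter> w = {}} \<le> card (ksets U s)"
    using R U(1) by (subst card_Un_disjoint[symmetric])
      (auto intro!: card_mono intro: finite_subset[OF _ finite_ksets])
  ultimately have RW: "card ?R + card ?W \<le> card U choose s"
    using card_ksets[OF U(1)] by simp
  have "card F = (card ?R + card (del i (link j F))) + (card ?P + card ?W)"
    using card_link_del[OF finF, of j] card_link_del[of "link j F" i] card_link_del[of "del j F" i]
      finite_subset[OF lj] finite_subset[OF dj] U(1) by simp
  moreover have "del i (link j F) = ?Q" using U(4) by (auto simp: link_def del_def)
  ultimately have cF: "card F = card ?R + card ?W + (card ?P + card ?Q)" by simp
  have "Suc (card U) choose Suc s = (card U choose s) + (card U choose Suc s)" by simp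
  moreover have "card V - 1 = Suc (card U)" "k - 1 = Suc s" "card V - k - 1 = card U - Suc s"
    using cV s by simp_all
  ultimately have "(card U choose s) + (card U choose Suc s) + 1 \<le> card F + ?c"
    using F(4) unfolding hm_large_def by simp
  then have eq: "card ?P + card ?Q + ?c = (card U choose Suc s) + 1"
    using cr RW cF by linarith
  then have cases: "card ?P = 1 \<or> card ?Q = 1 \<or> (s = 1 \<and> (\<exists>y. \<forall>A\<in>?P \<union> ?Q. y \<in> A))"
    using cr k cV s by auto
  \<comment> \<open>For \<open>w\<close> in \<open>?W\<close> all \<open>k\<close> sets
    \<open>w - {z}\<close> lie in both \<open>?P\<close> and \<open>?Q\<close>, so neither is a
    singleton. A common point \<open>y\<close> is impossible too, as it would lie in
    \<open>w\<close> but not in \<open>w - {y}\<close>.\<close>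
  have W0: "?W = {}"
  proof (rule ccontr)
    assume "?W \<noteq> {}"
    then obtain w where w: "w \<in> ?W" by blast
    then have wf: "finite w" "card w = k" "w \<subseteq> U" using W U(1) ksets_D by blast+
    have in': "w - {z} \<in> ?P" "w - {z} \<in> ?Q" if "z \<in> w" for z
      using down[OF w that] wf U by (auto simp: link_def del_def)
    have inj: "inj_on (\<lambda>z. w - {z}) w" by (auto simp: inj_on_def)
    have "card ((\<lambda>z. w - {z}) ` w) = k" using card_image[OF inj] wf by simp
    moreover have "(\<lambda>z. w - {z}) ` w \<subseteq> ?P" "(\<lambda>z. w - {z}) ` w \<subseteq> ?Q" using in' by blast+
    moreover have "finite ?P" "finite ?Q"
      using finite_subset[OF P] finite_subset[OF Q] U(1) by simp_all
    ultimately have "k \<le> card ?P" "k \<le> card ?Q" using card_mono by metis+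
    then obtain y where y: "\<forall>A\<in>?P \<union> ?Q. y \<in> A" using cases k by auto
    obtain z where "z \<in> w" using wf k by fastforce
    then have "y \<in> w" using in' y by blast
    then show False using in'[of y] y by blast
  qed
  \<comment> \<open>With \<open>?W\<close> empty, the members missing \<open>i\<close> correspond to
    \<open>?Q\<close> and those missing \<open>j\<close> to \<open>?P\<close>. A singleton side thus
    gives the first shape of \<open>hm_type\<close>, and a common point \<open>y\<close> gives the
    second with the triple \<open>{i, j, y}\<close>.\<close>
  have "del j (del i F) = {}" using W0 by (auto simp: del_def)
  then have cd: "card (del i F) = card ?Q" "card (del j F) = card ?P"
    using card_link_del[of "del i F" j] card_link_del[of "del j F" i] W0
    by (simp_all add: finite_subset[OF di] finite_subset[OF dj] U(1))
  show ?thesis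
    using cases
  proof (elim disjE conjE exE)
    fix y assume s1: "s = 1" and y: "\<forall>A\<in>?P \<union> ?Q. y \<in> A"
    obtain p where p: "p \<in> ?P" using ne by blast
    then have yU: "y \<in> U" using y P by (auto simp: ksets_def)
    have ij: "y \<noteq> i" "y \<noteq> j" using yU U by auto
    have "2 \<le> card (A \<inter> {i, j, y})" if A: "A \<in> F" for A
    proof -
      have *: "2 \<le> card (A \<inter> {i, j, y})" if "{a, b} \<subseteq> A \<inter> {i, j, y}" "a \<noteq> b" for a b
        using card_mono[of "A \<inter> {i, j, y}" "{a, b}"] that by simp
      consider "i \<in> A" "j \<in> A" | "i \<in> A" "j \<notin> A" | "i \<notin> A" "j \<in> A" | "i \<notin> A" "j \<notin> A" by blast
      then show ?thesis
      proof cases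
        case 1
        then show ?thesis using *[of i j] U by auto
      next
        case 2
        then have "A - {i} \<in> ?P" using A by (auto simp: link_def del_def insert_absorb)
        then show ?thesis using *[of i y] y ij 2 by blast
      next
        case 3
        then have "A - {j} \<in> ?Q" using A by (auto simp: link_def del_def insert_absorb)
        then show ?thesis using *[of j y] y ij 3 by blast
      next
        case 4
        then have "A \<in> ?W" using A by (auto simp: del_def)
        then show ?thesis using W0 by blast
      qed
    qed
    moreover have "card {i, j, y} = 3" using ij U by simp
    moreover have "{i, j, y} \<subseteq> V" using yU V by blast
    ultimately have "\<exists>D\<subseteq>V. card D = 3 \<and> (\<forall>A\<in>F. 2 \<le> card (A \<inter> D))"
      by (intro exI[of _ "{i, j, y}"]) simp
    then show ?thesis using s1 s unfolding hm_type_def by simp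
  qed (use cd V in \<open>auto simp: hm_type_def\<close>)
qed

section \<open>The shift operation\<close>

text \<open>The usual compression: a member containing \<open>j\<close> but not \<open>i\<close> has
  \<open>j\<close> replaced by \<open>i\<close> unless the result is already a member. Written as a
  membership test rather than as an image, it makes statements about links and deletions case
  distinctions.\<close>

definition shift :: "'a \<Rightarrow> 'a \<Rightarrow> 'a set set \<Rightarrow> 'a set set" where
  "shift i j F = {A. if i \<in> A \<and> j \<notin> A then A \<in> F \<or> insert j (A - {i}) \<in> F
     else if j \<in> A \<and> i \<notin> A then A \<in> F \<and> insert i (A - {j}) \<in> F else A \<in> F}"

lemma swap_swap: "i \<in> A \<Longrightarrow> j \<notin> A \<Longrightarrow> insert i (insert j (A - {i}) - {j}) = A"
  by blast

text \<open>The sets lost and the sets gained correspond under replacing \<open>j\<close> by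
  \<open>i\<close>. Size, point sum and intersections of the shifted family are read off these two
  differences.\<close>

lemma diff_shift:
  assumes "i \<noteq> j"
  shows "F - shift i j F = {A \<in> F. j \<in> A \<and> i \<notin> A \<and> insert i (A - {j}) \<notin> F}"
    and "shift i j F - F = (\<lambda>A. insert i (A - {j})) ` (F - shift i j F)"
proof -
  show 1: "F - shift i j F = {A \<in> F. j \<in> A \<and> i \<notin> A \<and> insert i (A - {j}) \<notin> F}"
    by (auto simp: shift_def)
  show "shift i j F - F = (\<lambda>A. insert i (A - {j})) ` (F - shift i j F)"
  proof (intro equalityI subsetI)
    fix A assume "A \<in> shift i j F - F"
    then have A: "i \<in> A" "j \<notin> A" "insert j (A - {i}) \<in> F" "A \<notin> F"
      by (auto simp: shift_def split: if_splits)
    then have "insert j (A - {i}) \<in> F - shift i j F"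
      unfolding 1 using assms swap_swap[OF A(1,2)] by simp
    then show "A \<in> (\<lambda>A. insert i (A - {j})) ` (F - shift i j F)"
      using swap_swap[OF A(1,2)] by (metis image_eqI)
  next
    fix A assume "A \<in> (\<lambda>A. insert i (A - {j})) ` (F - shift i j F)"
    then obtain B where B: "B \<in> F" "j \<in> B" "i \<notin> B" "insert i (B - {j}) \<notin> F" "A = insert i (B - {j})"
      unfolding 1 by blast
    then show "A \<in> shift i j F - F"
      using assms swap_swap[of j B i] by (simp add: shift_def)
  qed
qed

lemma inj_on_diff_shift: "i \<noteq> j \<Longrightarrow> inj_on (\<lambda>A. insert i (A - {j})) (F - shift i j F)"
  by (rule inj_onI) (metis (no_types, lifting) diff_shift(1) mem_Collect_eq swap_swap)

lemma finite_shift: "i \<noteq> j \<Longrightarrow> finite F \<Longrightarrow> finite (shift i j F)"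
  using diff_shift(2)[of i j F] by (metis finite_Diff finite_Diff2 finite_imageI)

lemma card_shift:
  assumes "i \<noteq> j" "finite F"
  shows "card (shift i j F) = card F"
proof -
  have "card (shift i j F - F) = card (F - shift i j F)"
    using diff_shift(2)[OF assms(1)] card_image[OF inj_on_diff_shift[OF assms(1)]] by metis
  then show ?thesis
    using assms finite_shift[OF assms] card_Int_Diff[of "shift i j F" F] card_Int_Diff[of F "shift i j F"]
    by (simp add: Int_commute)
qed

text \<open>Each replaced set gets the smaller \<open>i\<close> for \<open>j\<close>. The sum serves
  as the termination measure for repeated shifting.\<close>

lemma sum_shift_less:
  fixes i j :: nat
  assumes "i < j" "finite F" "\<forall>A\<in>F. finite A" "shift i j F \<noteq> F"
  shows "(\<Sum>A\<in>shift i j F. \<Sum>A) < (\<Sum>A\<in>F. \<Sum>A)"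
proof -
  have ij: "i \<noteq> j" using assms(1) by simp
  have fin: "finite (shift i j F)" using finite_shift[OF ij assms(2)] .
  have ne: "F - shift i j F \<noteq> {}" using assms(4) diff_shift(2)[OF ij] by (metis Diff_eq_empty_iff equalityI image_is_empty)
  have less: "\<Sum>(insert i (A - {j})) < \<Sum>A" if "A \<in> F - shift i j F" for A
  proof -
    have A: "A \<in> F" "j \<in> A" "i \<notin> A" using that unfolding diff_shift(1)[OF ij] by auto
    then have "\<Sum>A = j + \<Sum>(A - {j})" using assms(3) sum.remove[of A j "\<lambda>x. x"] by simp
    then show ?thesis using A assms(1,3) by simp
  qed
  have "(\<Sum>A\<in>shift i j F - F. \<Sum>A) = (\<Sum>A\<in>F - shift i j F. \<Sum>(insert i (A - {j})))"
    unfolding diff_shift(2)[OF ij] by (subst sum.reindex[OF inj_on_diff_shift[OF ij]]) simp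
  also have "\<dots> < (\<Sum>A\<in>F - shift i j F. \<Sum>A)"
    using ne assms(2) less by (intro sum_strict_mono) auto
  finally show ?thesis
    using sum.Int_Diff[of F "\<Sum>" "shift i j F"] sum.Int_Diff[of "shift i j F" "\<Sum>" F] assms(2) fin
    by (simp add: Int_commute)
qed

lemma shift_ksets:
  assumes "i \<in> V" "i \<noteq> j" "finite V" "F \<subseteq> ksets V k"
  shows "shift i j F \<subseteq> ksets V k"
proof
  fix A assume A: "A \<in> shift i j F"
  show "A \<in> ksets V k"
  proof (cases "A \<in> F")
    case False
    then have "A \<in> shift i j F - F" using A by blast
    then obtain B where B: "B \<in> F" "j \<in> B" "i \<notin> B" "A = insert i (B - {j})"
      unfolding diff_shift(2)[OF assms(2)] diff_shift(1)[OF assms(2)] by blast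
    then have "finite B" "B \<subseteq> V" "card B = k"
      using ksets_D[OF subsetD[OF assms(4) B(1)] assms(3)] by simp_all
    then show ?thesis
      using B assms(1) card_Suc_Diff1[of B j] by (auto simp: ksets_def)
  qed (use assms in blast)
qed

text \<open>New sets share \<open>i\<close>. If a new set were disjoint from an old set
  \<open>B\<close> that is kept, its original \<open>A'\<close> would meet \<open>B\<close> only in
  \<open>j\<close>; but then \<open>B\<close> is kept only because \<open>insert i (B - {j})\<close>
  is in \<open>F\<close> as well, and this set is disjoint from \<open>A'\<close>.\<close>

lemma intersecting_shift:
  assumes "i \<noteq> j" "intersecting F"
  shows "intersecting (shift i j F)"
proof -
  have mixed: "A \<inter> B \<noteq> {}" if A: "A \<in> shift i j F - F" and B: "B \<in> shift i j F" "B \<in> F" for A B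
  proof
    assume e: "A \<inter> B = {}"
    obtain A' where A': "A' \<in> F" "j \<in> A'" "i \<notin> A'" "A = insert i (A' - {j})"
      using A unfolding diff_shift(2)[OF assms(1)] diff_shift(1)[OF assms(1)] by blast
    have "A' \<inter> B \<noteq> {}" using intersectingD[OF assms(2)] A'(1) B(2) by blast
    then have jB: "j \<in> B" "i \<notin> B" using e A' by blast+
    then have "insert i (B - {j}) \<in> F" using B by (simp add: shift_def)
    then have "A' \<inter> insert i (B - {j}) \<noteq> {}" using intersectingD[OF assms(2)] A'(1) by blast
    then show False using e A' by blast
  qed
  have new: "i \<in> A" if "A \<in> shift i j F - F" for A
    using that unfolding diff_shift(2)[OF assms(1)] by blast
  show ?thesis unfolding intersecting_def
  proof (intro ballI)
    fix A B assume "A \<in> shift i j F" "B \<in> shift i j F"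
    then show "A \<inter> B \<noteq> {}"
      using mixed[of A B] mixed[of B A] new[of A] new[of B] intersectingD[OF assms(2), of A B]
      by (cases "A \<in> F"; cases "B \<in> F") auto
  qed
qed

text \<open>Undoing a shift means recovering the two mixed parts of \<open>F\<close> from their
  union and their intersection, which is the situation of
  \<open>cross_intersecting_partition\<close>.\<close>

lemma link_shift:
  assumes "i \<noteq> j"
  shows "link i (del j (shift i j F)) = link i (del j F) \<union> link j (del i F)"
    and "link j (del i (shift i j F)) = link i (del j F) \<inter> link j (del i F)"
    and "link i (link j (shift i j F)) = link i (link j F)"
    and "del i (del j (shift i j F)) = del i (del j F)"
  using assms by (auto simp: link_def del_def shift_def)

lemma del_shift_other:
  assumes "x \<noteq> i" "x \<noteq> j"
  shows "del x (shift i j F) = shift i j (del x F)"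
  using assms by (auto simp: del_def shift_def)

section \<open>Sizes of the two extremal shapes\<close>

text \<open>Members through \<open>x\<close> correspond to \<open>(k - 1)\<close>-sets meeting
  \<open>B\<close>, the only member that misses \<open>x\<close>; counting these sets gives the
  bound, and a large family has to use all of them.\<close>

lemma hm_star:
  assumes V: "finite V" "x \<in> V" and F: "F \<subseteq> ksets V k" "intersecting F" and B: "del x F = {B}"
    and k: "1 \<le> k"
  shows "B \<in> ksets (V - {x}) k"
    and "card F + (card V - k - 1 choose (k - 1)) \<le> (card V - 1 choose (k - 1)) + 1"
    and "hm_large V k F \<Longrightarrow> link x F = {u \<in> ksets (V - {x}) (k - 1). u \<inter> B \<noteq> {}}"
proof -
  let ?Z = "{u \<in> ksets (V - {x}) (k - 1). u \<inter> B \<noteq> {}}"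
  have V': "insert x (V - {x}) = V" "finite (V - {x})" using V by auto
  have "B \<in> del x F" using B by simp
  then have BF: "B \<in> F" "x \<notin> B" by (auto simp: del_def)
  then show BV: "B \<in> ksets (V - {x}) k" using F(1) by (auto simp: ksets_def)
  have "link x F \<subseteq> ksets (V - {x}) (k - 1)"
    by (rule link_ksets[OF V'(2)]) (use V'(1) F(1) k in simp)
  moreover have "u \<inter> B \<noteq> {}" if "u \<in> link x F" for u
  proof -
    have "insert x u \<in> F" using that by (simp add: link_def)
    then have "insert x u \<inter> B \<noteq> {}" by (rule intersectingD[OF F(2) _ BF(1)])
    then show ?thesis using BF(2) by blast
  qed
  ultimately have sub: "link x F \<subseteq> ?Z" by blast
  have finZ: "finite ?Z" using V'(2) by simp
  have "card ?Z + (card (V - {x}) - card B choose (k - 1)) = card (V - {x}) choose (k - 1)"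
    using BV by (intro card_ksets_meeting[OF V'(2)]) (auto simp: ksets_def)
  moreover have "card (V - {x}) = card V - 1" "card B = k" using V BV by (auto simp: ksets_def)
  ultimately have cZ: "card ?Z + (card V - k - 1 choose (k - 1)) = card V - 1 choose (k - 1)"
    by (simp add: diff_commute)
  have finF: "finite F" by (rule finite_subset[OF F(1) finite_ksets[OF V(1)]])
  have cF: "card F = card (link x F) + 1" using card_link_del[OF finF, of x] B by simp
  show "card F + (card V - k - 1 choose (k - 1)) \<le> (card V - 1 choose (k - 1)) + 1"
    using cF cZ card_mono[OF finZ sub] by linarith
  assume "hm_large V k F"
  then have "card ?Z \<le> card (link x F)" using cF cZ unfolding hm_large_def by linarith
  then show "link x F = ?Z" using card_seteq[OF finZ sub] by blast
qed

text \<open>The count splits at a point \<open>a\<close> of \<open>D = {a, b, c}\<close>: the link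
  of \<open>a\<close> consists of pairs meeting \<open>{b, c}\<close>, and a member without
  \<open>a\<close> is some \<open>{b, c, z}\<close>. With \<open>card V = r + 4\<close> the two
  counts add up to the bound because \<open>Suc r choose 2\<close> is
  \<open>r + (r choose 2)\<close>.\<close>

lemma hm_triple:
  assumes V: "finite V" "4 \<le> card V" and D: "D \<subseteq> V" "card D = 3"
    and F: "F \<subseteq> ksets V 3" "\<forall>A\<in>F. 2 \<le> card (A \<inter> D)"
  shows "card F + (card V - 3 - 1 choose (3 - 1)) \<le> (card V - 1 choose (3 - 1)) + 1"
    and "hm_large V 3 F \<Longrightarrow> F = {A \<in> ksets V 3. 2 \<le> card (A \<inter> D)}"
proof -
  obtain a b c where abc: "D = {a, b, c}" "a \<noteq> b" "a \<noteq> c" "b \<noteq> c"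
    using D(2) by (auto simp: card_3_iff)
  let ?T = "{A \<in> ksets V 3. 2 \<le> card (A \<inter> D)}"
  have V': "insert a (V - {a}) = V" "finite (V - {a})" using V D abc by auto
  have finT: "finite ?T" using V by simp
  have two: "b \<in> A \<and> c \<in> A" if "2 \<le> card (A \<inter> D)" "a \<notin> A" for A
  proof (rule ccontr)
    assume "\<not> ?thesis"
    then have "A \<inter> D \<subseteq> {b} \<or> A \<inter> D \<subseteq> {c}" using that(2) abc by blast
    then have "card (A \<inter> D) \<le> 1" using card_mono[of "{b}"] card_mono[of "{c}"] by fastforce
    then show False using that(1) by simp
  qed
  have "link a ?T \<subseteq> {u \<in> ksets (V - {a}) 2. u \<inter> {b, c} \<noteq> {}}"
  proof
    fix u assume u: "u \<in> link a ?T"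
    have "link a ?T \<subseteq> ksets (V - {a}) 2"
      by (rule link_ksets[OF V'(2)]) (use V'(1) in auto)
    moreover have "u \<inter> {b, c} \<noteq> {}"
    proof
      assume "u \<inter> {b, c} = {}"
      then have "insert a u \<inter> D \<subseteq> {a}" using abc by blast
      then have "card (insert a u \<inter> D) \<le> 1" using card_mono[of "{a}"] by fastforce
      then show False using u by (simp add: link_def)
    qed
    ultimately show "u \<in> {u \<in> ksets (V - {a}) 2. u \<inter> {b, c} \<noteq> {}}" using u by blast
  qed
  then have l: "card (link a ?T) \<le> card {u \<in> ksets (V - {a}) 2. u \<inter> {b, c} \<noteq> {}}"
    using V'(2) by (intro card_mono) auto
  have "card {u \<in> ksets (V - {a}) 2. u \<inter> {b, c} \<noteq> {}} + (card (V - {a}) - card {b, c} choose 2)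
      = card (V - {a}) choose 2"
    using abc D by (intro card_ksets_meeting[OF V'(2)]) auto
  moreover have "card (V - {a}) = card V - 1" "card {b, c} = 2" using V D abc by auto
  moreover obtain r where r: "card V = r + 4" using V(2) by (metis le_Suc_ex add.commute)
  ultimately have m: "card {u \<in> ksets (V - {a}) 2. u \<inter> {b, c} \<noteq> {}} + (Suc r choose 2) = r + 3 choose 2"
    by (simp only:) (simp add: add.commute)
  have "del a ?T \<subseteq> (\<lambda>z. {b, c, z}) ` (V - D)"
  proof
    fix A assume "A \<in> del a ?T"
    then have A: "A \<in> ksets V 3" "2 \<le> card (A \<inter> D)" "a \<notin> A" by (auto simp: del_def)
    then have bc: "b \<in> A" "c \<in> A" using two by blast+
    have fA: "finite A" "card A = 3" "A \<subseteq> V" using ksets_D[OF A(1) V(1)] by auto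
    then have "card (A - {b, c}) = 1" using bc abc by (simp add: card_Diff_subset)
    then obtain z where z: "A - {b, c} = {z}" by (auto simp: card_1_singleton_iff)
    then have "A = {b, c, z}" "z \<in> V - D" using bc fA abc A(3) by blast+
    then show "A \<in> (\<lambda>z. {b, c, z}) ` (V - D)" by blast
  qed
  then have "card (del a ?T) \<le> card (V - D)"
    using V by (meson surj_card_le finite_Diff)
  also have "\<dots> = r + 1" using V D r by (simp add: card_Diff_subset finite_subset)
  finally have d: "card (del a ?T) \<le> r + 1" .
  have "(Suc r choose 2) = r + (r choose 2)" by (simp add: numeral_2_eq_2)
  moreover have "card V - 3 - 1 = r" "card V - 1 = r + 3" "3 - 1 = (2::nat)" using r by simp_all
  ultimately have cT: "card ?T + (card V - 3 - 1 choose (3 - 1)) \<le> (card V - 1 choose (3 - 1)) + 1"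
    using card_link_del[OF finT, of a] l m d by presburger
  have sub: "F \<subseteq> ?T" using F by blast
  have c: "card F \<le> card ?T" by (rule card_mono[OF finT sub])
  then show "card F + (card V - 3 - 1 choose (3 - 1)) \<le> (card V - 1 choose (3 - 1)) + 1"
    using cT by simp
  assume "hm_large V 3 F"
  then have "card ?T \<le> card F" using cT by (simp add: hm_large_def)
  then show "F = ?T" using card_seteq[OF finT sub] by blast
qed

text \<open>Used for saturation: if adding a set to a large family gave a family of type
  \<open>hm_type\<close>, this bound would be exceeded.\<close>

lemma hm_type_card_le:
  assumes "finite V" "4 \<le> card V" "F \<subseteq> ksets V k" "intersecting F" "1 \<le> k" "hm_type V k F"
  shows "card F + (card V - k - 1 choose (k - 1)) \<le> (card V - 1 choose (k - 1)) + 1"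
  using assms(6) unfolding hm_type_def
proof (elim disjE conjE bexE exE)
  fix x assume "x \<in> V" "card (del x F) = 1"
  then show ?thesis using hm_star(2)[OF assms(1) _ assms(3,4) _ assms(5)] by (auto simp: card_1_singleton_iff)
next
  fix D assume k: "k = 3" and D: "D \<subseteq> V" "card D = 3" "\<forall>A\<in>F. 2 \<le> card (A \<inter> D)"
  show ?thesis using hm_triple(1)[OF assms(1,2) D(1,2) _ D(3)] assms(3) unfolding k by blast
qed

section \<open>Carrying the extremal shapes back along a shift\<close>

text \<open>The critical cases are those where the distinguished point is \<open>i\<close>, or the
  triple contains \<open>i\<close> but not \<open>j\<close>; otherwise the shape passes to
  \<open>F\<close> directly. In the critical cases largeness determines \<open>G\<close>, so that
  \<open>?P\<close> and \<open>?Q\<close> together are the \<open>(k - 1)\<close>-sets of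
  \<open>U\<close> meeting some \<open>C\<close> and share at most \<open>C\<close>. Then
  \<open>cross_intersecting_partition\<close> confines one of them to \<open>{C}\<close>.\<close>

lemma hm_type_unshift:
  fixes i j :: "'a::linorder"
  assumes V: "finite V" "i \<in> V" "j \<in> V" "i \<noteq> j" "2 * k < card V" and k: "3 \<le> k"
    and F: "F \<subseteq> ksets V k" "intersecting F" "\<forall>x\<in>V. del x F \<noteq> {}" "hm_large V k F"
    and G: "hm_type V k (shift i j F)"
  shows "hm_type V k F"
proof -
  define G where "G = shift i j F"
  define U where "U = V - {i, j}"
  let ?P = "link i (del j F)" and ?Q = "link j (del i F)"
  have finF: "finite F" by (rule finite_subset[OF F(1) finite_ksets[OF V(1)]])
  have Gk: "G \<subseteq> ksets V k" unfolding G_def by (rule shift_ksets[OF V(2,4,1) F(1)])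
  have Gi: "intersecting G" unfolding G_def by (rule intersecting_shift[OF V(4) F(2)])
  have cG: "card G = card F" unfolding G_def by (rule card_shift[OF V(4) finF])
  then have Gl: "hm_large V k G" using F(4) by (simp add: hm_large_def)
  have finU: "finite U" and cU: "card U = card V - 2" and ijU: "i \<notin> U" "j \<notin> U"
    using V by (auto simp: U_def card_Diff_subset)
  have Vij: "V - {i} = insert j U" "V - {j} = insert i U" using V by (auto simp: U_def)
  have V4: "4 \<le> card V" using V(5) k by simp
  have one: "hm_type V k F" if "x \<in> V" "card (del x F) \<le> 1" for x
  proof -
    have "card (del x F) \<noteq> 0" using F(3) that(1) finF by simp
    then have "card (del x F) = 1" using that(2) by linarith
    then show ?thesis using that(1) unfolding hm_type_def by blast
  qed
  have PQ: "link i (del j G) = ?P \<union> ?Q" "link j (del i G) = ?P \<inter> ?Q"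
    "link i (link j G) = link i (link j F)" "del i (del j G) = del i (del j F)"
    unfolding G_def by (simp_all add: link_shift[OF V(4)])
  have djF: "card (del j F) = card ?P + card (del i (del j F))"
    by (rule card_link_del) (simp add: finF)
  have "del j (del i F) = del i (del j F)" by (auto simp: del_def)
  then have diF: "card (del i F) = card ?Q + card (del i (del j F))"
    using card_link_del[OF finite_del[OF finF], of i j] by simp
  have cross: "\<forall>p\<in>?P. \<forall>q\<in>?Q. p \<inter> q \<noteq> {}"
  proof (intro ballI)
    fix p q assume "p \<in> ?P" "q \<in> ?Q"
    then have pq: "insert i p \<in> F" "j \<notin> p" "insert j q \<in> F" "i \<notin> q" by (auto simp: link_def del_def)
    then have "insert i p \<inter> insert j q \<noteq> {}" using intersectingD[OF F(2)] by blast
    then show "p \<inter> q \<noteq> {}" using pq V(4) by blast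
  qed
  \<comment> \<open>With \<open>m = k - 1\<close> the size condition is
    \<open>2 * k - 1 \<le> card V - 2\<close>, that is \<open>2 * k < card V\<close>.\<close>
  have sides: "?P \<subseteq> {C} \<or> ?Q \<subseteq> {C}"
    if "C \<subseteq> U" "k - 1 \<le> card C" "link i (del j G) = {u \<in> ksets U (k - 1). u \<inter> C \<noteq> {}}"
      "link j (del i G) \<subseteq> {C}" for C
    by (rule cross_intersecting_partition[OF finU _ _ that(1,2) _ _ cross])
      (use that cU V(5) k PQ in auto)
  have "(\<exists>x\<in>V. card (del x G) = 1) \<or>
    (k = 3 \<and> (\<exists>D\<subseteq>V. card D = 3 \<and> (\<forall>A\<in>G. 2 \<le> card (A \<inter> D))))"
    using G unfolding hm_type_def G_def .
  then show ?thesis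
  proof (elim disjE conjE bexE exE)
    fix x assume x: "x \<in> V" "card (del x G) = 1"
    consider "x \<noteq> i" "x \<noteq> j" | "x = j" | "x = i" by blast
    then show ?thesis
    proof cases
      case 1
      have "finite (del x F)" using finF by simp
      then have "card (del x G) = card (del x F)"
        using del_shift_other[OF 1] card_shift[OF V(4)] by (metis G_def)
      then show ?thesis using one x by simp
    next
      case 2
      have "del j F \<subseteq> del j G" unfolding G_def by (auto simp: del_def shift_def)
      moreover have "finite (del j G)" using finite_shift[OF V(4) finF] by (simp add: G_def)
      ultimately have "card (del j F) \<le> 1" using card_mono x(2) 2 by metis
      then show ?thesis using one V(3) by blast
    next
      case 3
      then obtain B where B: "del i G = {B}" using x(2) by (auto simp: card_1_singleton_iff)
      have k1: "1 \<le> k" using k by simp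
      have BV: "B \<in> ksets (V - {i}) k" by (rule hm_star(1)[OF V(1,2) Gk Gi B k1])
      have li: "link i G = {u \<in> ksets (V - {i}) (k - 1). u \<inter> B \<noteq> {}}"
        by (rule hm_star(3)[OF V(1,2) Gk Gi B k1 Gl])
      have fB: "finite B" "card B = k" "B \<subseteq> V - {i}" using BV V(1) by (auto simp: ksets_def finite_subset)
      define C where "C = B - {j}"
      have C: "C \<subseteq> U" "k - 1 \<le> card C" using fB by (auto simp: C_def U_def card_Diff_singleton_if)
      have "link i (del j G) = del j (link i G)" using V(4) by (auto simp: link_def del_def)
      also have "\<dots> = {u \<in> ksets U (k - 1). u \<inter> C \<noteq> {}}"
        unfolding li C_def U_def by (auto simp: del_def ksets_def)
      finally have un: "link i (del j G) = {u \<in> ksets U (k - 1). u \<inter> C \<noteq> {}}" .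
      have int: "link j (del i G) \<subseteq> {C}" unfolding B by (auto simp: link_def C_def)
      have PQk: "?P \<union> ?Q \<subseteq> ksets U (k - 1)" using PQ(1) un by blast
      have W: "j \<in> B \<Longrightarrow> del i (del j F) = {}" "card (del i (del j F)) \<le> 1"
      proof -
        have "del i (del j G) = del j {B}" using B by (auto simp: del_def)
        then have W: "del i (del j F) = del j {B}" using PQ(4) by simp
        then show "j \<in> B \<Longrightarrow> del i (del j F) = {}" by (simp add: del_def)
        show "card (del i (del j F)) \<le> 1" unfolding W using card_mono[of "{B}" "del j {B}"] by (auto simp: del_def)
      qed
      \<comment> \<open>If \<open>B\<close> contains \<open>j\<close>, no member misses both
        \<open>i\<close> and \<open>j\<close>. Otherwise \<open>C = B\<close> has \<open>k\<close>
        points and is no \<open>(k - 1)\<close>-set, so \<open>R\<close> is empty.\<close>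
      have small: "card R + card (del i (del j F)) \<le> 1" if R: "R \<subseteq> {C}" "R \<subseteq> ksets U (k - 1)" for R
      proof (cases "j \<in> B")
        case True
        then show ?thesis using W(1) R card_mono[of "{C}" R] by simp
      next
        case False
        then have CB: "C = B" by (simp add: C_def)
        have "k \<noteq> k - 1" using k by simp
        then have "C \<notin> ksets U (k - 1)" using fB(2) CB by (simp add: ksets_def)
        then have "R = {}" using R by blast
        then show ?thesis using W(2) by simp
      qed
      show ?thesis
        using sides[OF C un int]
      proof
        assume "?P \<subseteq> {C}"
        then have "card (del j F) \<le> 1" using small PQk unfolding djF by blast
        then show ?thesis using one V(3) by blast
      next
        assume "?Q \<subseteq> {C}"
        then have "card (del i F) \<le> 1" using small PQk unfolding diF by blast
        then show ?thesis using one V(2) by blast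
      qed
    qed
  next
    fix D assume k3: "k = 3" and D: "D \<subseteq> V" "card D = 3" "\<forall>A\<in>G. 2 \<le> card (A \<inter> D)"
    have finD: "finite D" using D(1) V(1) finite_subset by blast
    have result: "hm_type V k F" if "D' \<subseteq> V" "card D' = 3" "\<And>A. A \<in> F \<Longrightarrow> 2 \<le> card (A \<inter> D')" for D'
      using that k3 unfolding hm_type_def by blast
    show ?thesis
    proof (cases "i \<in> D \<and> j \<notin> D")
      case False
      \<comment> \<open>The same triple works for \<open>F\<close>: as \<open>D\<close> contains
        \<open>j\<close> or misses \<open>i\<close>, putting \<open>j\<close> back in place of
        \<open>i\<close> does not decrease the intersection with \<open>D\<close>.\<close>
      show ?thesis
      proof (rule result[OF D(1,2)])
        fix A assume A: "A \<in> F"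
        show "2 \<le> card (A \<inter> D)"
        proof (cases "A \<in> G")
          case F: False
          then have "A \<in> F - shift i j F" using A by (simp add: G_def)
          then have A': "j \<in> A" "i \<notin> A" "insert i (A - {j}) \<in> G"
            using diff_shift(2)[OF V(4), of F] diff_shift(1)[OF V(4), of F] unfolding G_def by blast+
          have "2 \<le> card (insert i (A - {j}) \<inter> D)" using D(3) A'(3) by blast
          also have "\<dots> \<le> card (A \<inter> D)"
          proof (cases "i \<in> D")
            case True
            then have "j \<in> D" using False by blast
            then have "insert i (A - {j}) \<inter> D = insert i (A \<inter> D - {j})" "j \<in> A \<inter> D"
              using True A' by blast+
            then show ?thesis using A'(2) finD card_Suc_Diff1[of "A \<inter> D" j] by simp
          next
            case nD: False
            then show ?thesis using finD by (intro card_mono) auto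
          qed
          finally show ?thesis .
        qed (use D(3) in blast)
      qed
    next
      case iD: True
      \<comment> \<open>The triple for \<open>F\<close> will be \<open>C\<close> with
        \<open>j\<close> if \<open>?P\<close> is confined to \<open>{C}\<close>, and
        \<open>C\<close> with \<open>i\<close> if \<open>?Q\<close> is.\<close>
      define C where "C = D - {i}"
      have C: "C \<subseteq> U" "card C = 2" "finite C" using D iD finD by (auto simp: C_def U_def)
      have Di: "D = insert i C" "i \<notin> C" using iD by (auto simp: C_def)
      have "hm_large V 3 G" "G \<subseteq> ksets V 3" using Gl Gk k3 by simp_all
      then have GT: "G = {A \<in> ksets V 3. 2 \<le> card (A \<inter> D)}"
        using hm_triple(2)[OF V(1) V4 D(1,2) _ D(3)] by blast
      have iff: "2 \<le> card (insert i u \<inter> D) \<longleftrightarrow> u \<inter> C \<noteq> {}" if "i \<notin> u" for u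
      proof -
        have "insert i u \<inter> D = insert i (u \<inter> C)" using Di by blast
        then have "card (insert i u \<inter> D) = Suc (card (u \<inter> C))" using that C(3) by simp
        then show ?thesis using C(3) by (auto simp: Suc_le_eq card_gt_0_iff)
      qed
      have un: "link i (del j G) = {u \<in> ksets U (k - 1). u \<inter> C \<noteq> {}}"
      proof (intro equalityI subsetI)
        fix u assume "u \<in> link i (del j G)"
        then have u: "insert i u \<in> ksets V 3" "2 \<le> card (insert i u \<inter> D)" "i \<notin> u" "j \<notin> u"
          unfolding GT by (auto simp: link_def del_def)
        have "finite u" using ksets_D[OF u(1) V(1)] by simp
        then show "u \<in> {u \<in> ksets U (k - 1). u \<inter> C \<noteq> {}}"
          using u iff[OF u(3)] k3 by (auto simp: ksets_def U_def)
      next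
        fix u assume "u \<in> {u \<in> ksets U (k - 1). u \<inter> C \<noteq> {}}"
        then have u: "u \<subseteq> U" "card u = 2" "u \<inter> C \<noteq> {}" using k3 by (auto simp: ksets_def)
        then have "finite u" "i \<notin> u" "j \<notin> u" using finU finite_subset ijU by blast+
        moreover from this have "insert i u \<in> G"
          using u iff[of u] V(2) unfolding GT U_def by (auto simp: ksets_def)
        ultimately show "u \<in> link i (del j G)" using V(4) by (auto simp: link_def del_def)
      qed
      have int: "link j (del i G) \<subseteq> {C}"
      proof
        fix u assume "u \<in> link j (del i G)"
        then have u: "insert j u \<in> ksets V 3" "2 \<le> card (insert j u \<inter> D)" "i \<notin> u" "j \<notin> u"
          unfolding GT by (auto simp: link_def del_def)
        have "insert j u \<inter> D = u \<inter> C" using Di iD u by blast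
        then have "C \<subseteq> u" using u(2) C card_seteq[OF C(3), of "u \<inter> C"] by auto
        moreover have "finite u" "card u = 2" using ksets_D[OF u(1) V(1)] u(4) by auto
        ultimately show "u \<in> {C}" using card_subset_eq[of u C] C by simp
      qed
      have C': "k - 1 \<le> card C" using C k3 by simp
      have "j \<notin> C" using C(1) ijU(2) by blast
      then have jD: "insert j C \<subseteq> V" "card (insert j C) = 3"
        using C V(3) by (auto simp: U_def)
      have meetC: "u \<inter> C \<noteq> {}" if "u \<in> ?P \<union> ?Q" for u using that PQ(1) un by blast
      \<comment> \<open>A member containing \<open>x\<close> has a further point in
        \<open>C\<close>. A member without \<open>x\<close> contains all of \<open>C\<close>: if it
        contains the other point, removing that point leaves a set of the confined part; if it
        misses both points, it belongs to \<open>G\<close>.\<close>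
      have both: "2 \<le> card (A \<inter> insert x C)"
        if A: "A \<in> F" and x: "x \<in> {i, j}" and P: "\<And>u. u \<in> (if x = i then ?Q else ?P) \<Longrightarrow> u = C" for A x
      proof (cases "x \<in> A")
        case True
        have "A \<inter> C \<noteq> {}"
        proof -
          consider "i \<in> A" "j \<in> A" | "i \<in> A" "j \<notin> A" | "i \<notin> A" "j \<in> A" using True x by blast
          then show ?thesis
          proof cases
            case 1
            then have "A \<in> G" using A by (simp add: G_def shift_def)
            then have "2 \<le> card (insert i (A - {i}) \<inter> D)" using D(3) 1(1) by (simp add: insert_absorb)
            then have "(A - {i}) \<inter> C \<noteq> {}" using iff[of "A - {i}"] by blast
            then show ?thesis by blast
          next
            case 2
            then have "A - {i} \<in> ?P" using A by (auto simp: link_def del_def insert_absorb)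
            then show ?thesis using meetC by blast
          next
            case 3
            then have "A - {j} \<in> ?Q" using A by (auto simp: link_def del_def insert_absorb)
            then show ?thesis using meetC by blast
          qed
        qed
        moreover have "A \<inter> insert x C = insert x (A \<inter> C)" using True by blast
        moreover have "x \<notin> C" using x C(1) ijU by blast
        ultimately show ?thesis using C(3) by (auto simp: Suc_le_eq card_gt_0_iff)
      next
        case False
        have "C \<subseteq> A"
        proof (cases "i \<in> A \<or> j \<in> A")
          case True
          then have "(if x = i then j else i) \<in> A" using x False by auto
          then have "A - {if x = i then j else i} \<in> (if x = i then ?Q else ?P)"
            using A False x V(4) by (auto simp: link_def del_def insert_absorb)
          then show ?thesis using P by blast
        next
          case nij: False
          then have "A \<in> G" using A by (simp add: G_def shift_def)
          then have "2 \<le> card (A \<inter> D)" using D(3) by blast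
          also have "A \<inter> D = A \<inter> C" using Di nij by blast
          finally show ?thesis using C card_seteq[OF C(3), of "A \<inter> C"] by auto
        qed
        then have "C \<subseteq> A \<inter> insert x C" by blast
        then show ?thesis using C card_mono[of "A \<inter> insert x C" C] by simp
      qed
      show ?thesis
        using sides[OF C(1) C' un int]
      proof
        assume "?P \<subseteq> {C}"
        then show ?thesis using result[OF jD] both[of _ j] V(4) by auto
      next
        assume "?Q \<subseteq> {C}"
        then show ?thesis using result[OF D(1,2)] both[of _ i] unfolding Di by auto
      qed
    qed
  qed
qed

text \<open>If some shift changes \<open>F\<close> without creating a common point, the induction
  continues with the shifted family and \<open>hm_type_unshift\<close> leads back. Otherwise either
  some shift creates a common point or \<open>F\<close> is fully shifted, and in both cases two
  points can be chosen for \<open>hm_type_if_shifted\<close>.\<close>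

lemma hilton_milner_structure:
  fixes V :: "nat set"
  assumes V: "finite V" "2 * k < card V" and k: "3 \<le> k"
    and "F \<subseteq> ksets V k" "intersecting F" "\<forall>x\<in>V. del x F \<noteq> {}" "hm_large V k F"
  shows "hm_type V k F"
  using assms(4-)
\<comment> \<open>The measure is lexicographic: adding a set decreases the first entry, while a
  shift preserves the size and decreases the point sum.\<close>
proof (induction F rule: wf_induct_rule[OF wf_measures[of "[\<lambda>F. (card V choose k) - card F, \<lambda>F. \<Sum>A\<in>F. \<Sum>A]"]])
  case (1 F)
  note IH = "1.IH" and F = "1.prems"
  have finF: "finite F" by (rule finite_subset[OF F(1) finite_ksets[OF V(1)]])
  have mem: "finite A" "A \<subseteq> V" "card A = k" if "A \<in> F" for A
    using ksets_D[OF subsetD[OF F(1) that] V(1)] by simp_all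
  \<comment> \<open>Otherwise the family enlarged by \<open>A\<close> would be of type
    \<open>hm_type\<close> by induction and at the same time exceed the bound of
    \<open>hm_type_card_le\<close>.\<close>
  have sat: "A \<in> F" if A: "A \<in> ksets V k" "\<And>B. B \<in> F \<Longrightarrow> A \<inter> B \<noteq> {}" for A
  proof (rule ccontr)
    assume nA: "A \<notin> F"
    have ne: "A \<noteq> {}" using A(1) k by (auto simp: ksets_def)
    have sub: "insert A F \<subseteq> ksets V k" using A(1) F(1) by blast
    have c: "card (insert A F) = card F + 1" using nA finF by simp
    have "card (insert A F) \<le> card V choose k"
      using card_mono[OF finite_ksets[OF V(1)] sub] card_ksets[OF V(1)] by simp
    then have "(card V choose k) - card (insert A F) < (card V choose k) - card F"
      using c by linarith
    then have less: "(insert A F, F) \<in> measures [\<lambda>F. (card V choose k) - card F, \<lambda>F. \<Sum>A\<in>F. \<Sum>A]"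
      unfolding in_measures by blast
    have int: "intersecting (insert A F)"
      unfolding intersecting_def
    proof (intro ballI)
      fix B C assume "B \<in> insert A F" "C \<in> insert A F"
      then show "B \<inter> C \<noteq> {}"
        using A(2)[of B] A(2)[of C] ne intersectingD[OF F(2), of B C] by (auto simp: Int_commute)
    qed
    have "hm_type V k (insert A F)"
    proof (rule IH[OF less sub int])
      show "\<forall>x\<in>V. del x (insert A F) \<noteq> {}" using F(3) by (auto simp: del_def)
      show "hm_large V k (insert A F)" using F(4) c by (simp add: hm_large_def)
    qed
    then have "card (insert A F) + (card V - k - 1 choose (k - 1)) \<le> (card V - 1 choose (k - 1)) + 1"
      using V k by (intro hm_type_card_le[OF V(1) _ sub int]) auto
    then show False using F(4) c unfolding hm_large_def by linarith
  qed
  \<comment> \<open>Only \<open>i\<close> can become a common point: sets missing \<open>j\<close>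
    survive the shift, and deleting any third point commutes with it. Sets missing both
    \<open>i\<close> and \<open>j\<close> are untouched, so there are none.\<close>
  have triv: "x = i" "del i (del j F) = {}"
    if ij: "i \<noteq> j" and x: "x \<in> V" "del x (shift i j F) = {}" for i j x
  proof -
    have "x \<noteq> j"
    proof
      assume "x = j"
      then have "del j F \<subseteq> del x (shift i j F)" by (auto simp: del_def shift_def)
      then show False using F(3) x \<open>x = j\<close> by blast
    qed
    moreover have "x = i \<or> x = j"
    proof (rule ccontr)
      assume "\<not> ?thesis"
      then have "shift i j (del x F) = {}" using x(2) del_shift_other[of x i j F] by simp
      then have "card (del x F) = 0" using card_shift[OF ij finite_del[OF finF], of x] by simp
      then show False using F(3) x(1) finF by simp
    qed
    ultimately show "x = i" by blast
    then show "del i (del j F) = {}"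
      using x(2) link_shift(4)[OF ij, of F] by (auto simp: del_def)
  qed
  show ?case
  proof (cases "\<exists>i\<in>V. \<exists>j\<in>V. i < j \<and> shift i j F \<noteq> F \<and> (\<forall>x\<in>V. del x (shift i j F) \<noteq> {})")
    case True
    then obtain i j where ij: "i \<in> V" "j \<in> V" "i < j" and sF: "shift i j F \<noteq> F" "\<forall>x\<in>V. del x (shift i j F) \<noteq> {}"
      by blast
    have ne: "i \<noteq> j" using ij by simp
    have c: "card (shift i j F) = card F" by (rule card_shift[OF ne finF])
    have "(\<Sum>A\<in>shift i j F. \<Sum>A) < (\<Sum>A\<in>F. \<Sum>A)"
      using sum_shift_less[OF ij(3) finF _ sF(1)] mem(1) by blast
    then have "(shift i j F, F) \<in> measures [\<lambda>F. (card V choose k) - card F, \<lambda>F. \<Sum>A\<in>F. \<Sum>A]"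
      using c by simp
    then have "hm_type V k (shift i j F)"
      using shift_ksets[OF ij(1) ne V(1) F(1)] intersecting_shift[OF ne F(2)] sF(2) F(4) c
      by (intro IH) (auto simp: hm_large_def)
    then show ?thesis by (rule hm_type_unshift[OF V(1) ij(1,2) ne V(2) k F])
  next
    case False
    then have stuck: "shift i j F = F \<or> (\<exists>x\<in>V. del x (shift i j F) = {})"
      if "i \<in> V" "j \<in> V" "i < j" for i j using that by blast
    have closed: "insert z (A - {x}) \<in> F"
      if "shift z x F = F" "A \<in> F" "x \<in> A" "z \<notin> A" for A x z
    proof -
      have "A \<in> shift z x F" using that by simp
      then show ?thesis using that by (simp add: shift_def)
    qed
    show ?thesis
    proof (cases "\<exists>i\<in>V. \<exists>j\<in>V. i < j \<and> (\<exists>x\<in>V. del x (shift i j F) = {})")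
      case True
      then obtain i j x where ij: "i \<in> V" "j \<in> V" "i < j" "x \<in> V" "del x (shift i j F) = {}" by blast
      have ne: "i \<noteq> j" using ij by simp
      have W: "del i (del j F) = {}" using triv(2)[OF ne ij(4,5)] .
      then have meets: "i \<in> A \<or> j \<in> A" if "A \<in> F" for A using that by (auto simp: del_def)
      \<comment> \<open>Every member meets \<open>{i, j}\<close>, so saturation yields all
        \<open>k\<close>-sets containing both points.\<close>
      have full: "A \<in> F" if "A \<in> ksets V k" "i \<in> A" "j \<in> A" for A
        by (rule sat[OF that(1)]) (use meets that in blast)
      let ?U = "V - {i, j}"
      have "shifted ?U F"
        unfolding shifted_def
      proof (intro ballI impI)
        fix A x z assume A: "A \<in> F" "x \<in> A \<inter> ?U" "z \<in> ?U - A" "z < x"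
        \<comment> \<open>A shift changing \<open>F\<close> would create a common point, so every
          member would meet \<open>{z, x}\<close>; a member containing \<open>i\<close> and
          \<open>j\<close> and avoiding \<open>z\<close> and \<open>x\<close> refutes this.\<close>
        have "shift z x F = F"
        proof (rule ccontr)
          assume "shift z x F \<noteq> F"
          then obtain y where "y \<in> V" "del y (shift z x F) = {}" using stuck[of z x] A by blast
          then have e: "del z (del x F) = {}" using triv(2)[of z x y] A(4) by simp
          have fin4: "finite {i, j, z, x}" "card {i, j, z, x} \<le> 4" by (simp_all add: card_insert_if)
          obtain s where s: "s \<in> ksets V (k - 2)" "s \<inter> {i, j, z, x} = {}"
            by (rule ksets_exists_avoiding[OF V(1) fin4(1), of "k - 2"]) (use fin4 V(2) k in auto)
          have fs: "finite s" "s \<subseteq> V" "card s = k - 2" using ksets_D[OF s(1) V(1)] by simp_all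
          have "i \<notin> s" "j \<notin> s" using s(2) by blast+
          then have "insert i (insert j s) \<in> ksets V k"
            using fs ij(1,2) ne k by (simp add: ksets_def)
          then have "insert i (insert j s) \<in> F" by (rule full) simp_all
          then have "insert i (insert j s) \<in> del z (del x F)" using A s(2) by (auto simp: del_def)
          then show False using e by blast
        qed
        then show "insert z (A - {x}) \<in> F" using closed A by blast
      qed
      moreover have "link i (del j F) \<noteq> {}"
      proof -
        obtain A where A: "A \<in> F" "j \<notin> A" using F(3) ij(2) by (auto simp: del_def)
        then have "i \<in> A" using meets by blast
        then have "A - {i} \<in> link i (del j F)" using A by (auto simp: link_def del_def insert_absorb)
        then show ?thesis by blast
      qed
      moreover have "link j (del i F) \<noteq> {}"
      proof -
        obtain A where A: "A \<in> F" "i \<notin> A" using F(3) ij(1) by (auto simp: del_def)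
        then have "j \<in> A" using meets by blast
        then have "A - {j} \<in> link j (del i F)" using A by (auto simp: link_def del_def insert_absorb)
        then show ?thesis by blast
      qed
      ultimately show ?thesis
        using V ij(1,2) ne W by (intro hm_type_if_shifted[OF _ _ _ ne _ F(1,2) _ F(4) k, of ?U]) auto
    next
      case nt: False
      have closed': "insert z (A - {x}) \<in> F"
        if "A \<in> F" "x \<in> A" "z \<notin> A" "z \<in> V" "x \<in> V" "z < x" for A x z
        using closed[OF _ that(1-3)] stuck[OF that(4,5,6)] nt that by blast
      \<comment> \<open>With the two smallest points as \<open>i\<close> and \<open>j\<close>, any
        other point of a member can be exchanged for whichever of them the member misses.\<close>
      define i where "i = Min V"
      define j where "j = Min (V - {i})"
      let ?U = "V - {i, j}"
      have "V \<noteq> {}" using V(2) by auto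
      then have i: "i \<in> V" "\<And>y. y \<in> V \<Longrightarrow> i \<le> y" using V(1) by (auto simp: i_def)
      have "card (V - {i}) > 0" using V(2) k i(1) V(1) by simp
      then have "V - {i} \<noteq> {}" by (metis card.empty less_irrefl)
      then have "j \<in> V - {i}" unfolding j_def using V(1) by (intro Min_in) auto
      then have j: "j \<in> V" "i \<noteq> j" "\<And>y. y \<in> V - {i} \<Longrightarrow> j \<le> y" using V(1) by (auto simp: j_def)
      have lt: "i < y" "j < y" if "y \<in> ?U" for y
        using i(2)[of y] j(3)[of y] that by auto
      have W: "A \<in> F" "A \<subseteq> ?U" if "A \<in> del i (del j F)" for A
        using that mem(2) by (auto simp: del_def)
      have down: "insert i (A - {y}) \<in> F" "insert j (A - {y}) \<in> F" if "A \<in> del i (del j F)" "y \<in> A" for A y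
        using that W[OF that(1)] closed'[of A y i] closed'[of A y j] lt[of y] i(1) j(1) by blast+
      show ?thesis
      proof (rule hm_type_if_shifted[OF _ _ _ j(2) _ F(1,2) _ F(4) k, of ?U])
        show "shifted ?U F" unfolding shifted_def using closed' by blast
        have pick: "A \<noteq> {}" if "A \<in> F" for A using mem(3)[OF that] k by auto
        show "link i (del j F) \<noteq> {}"
        proof -
          obtain A where A: "A \<in> F" "j \<notin> A" using F(3) j(1) by (auto simp: del_def)
          have "\<exists>B\<in>F. i \<in> B \<and> j \<notin> B"
          proof (cases "i \<in> A")
            case False
            then have "A \<in> del i (del j F)" using A by (simp add: del_def)
            then show ?thesis using down(1) pick[OF A(1)] A(2) j(2) by blast
          qed (use A in blast)
          then obtain B where "B \<in> F" "i \<in> B" "j \<notin> B" by blast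
          then have "B - {i} \<in> link i (del j F)" by (auto simp: link_def del_def insert_absorb)
          then show ?thesis by blast
        qed
        show "link j (del i F) \<noteq> {}"
        proof -
          obtain A where A: "A \<in> F" "i \<notin> A" using F(3) i(1) by (auto simp: del_def)
          have "\<exists>B\<in>F. j \<in> B \<and> i \<notin> B"
          proof (cases "j \<in> A")
            case False
            then have "A \<in> del i (del j F)" using A by (simp add: del_def)
            then show ?thesis using down(2) pick[OF A(1)] A(2) j(2) by blast
          qed (use A in blast)
          then obtain B where "B \<in> F" "j \<in> B" "i \<notin> B" by blast
          then have "B - {j} \<in> link j (del i F)" by (auto simp: link_def del_def insert_absorb)
          then show ?thesis by blast
        qed
        \<comment> \<open>If \<open>A\<close> and \<open>B\<close> met only in \<open>y\<close>,
          exchanging \<open>y\<close> for \<open>i\<close> in \<open>B\<close> would give a member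
          disjoint from \<open>A\<close>.\<close>
        show "2 \<le> card (A \<inter> B)" if AB: "A \<in> del i (del j F)" "B \<in> del i (del j F)" for A B
        proof (rule ccontr)
          assume "\<not> ?thesis"
          moreover have "A \<inter> B \<noteq> {}" using intersectingD[OF F(2)] W(1) AB by blast
          moreover have "finite (A \<inter> B)" using mem(1) W(1) AB by blast
          ultimately have "card (A \<inter> B) = 1"
            by (metis One_nat_def Suc_1 card_0_eq le_Suc_eq linear not_less_eq_eq le_zero_eq)
          then obtain y where y: "A \<inter> B = {y}" by (auto simp: card_1_singleton_iff)
          then have "insert i (B - {y}) \<in> F" using down(1) AB(2) by blast
          then have "A \<inter> insert i (B - {y}) \<noteq> {}" using intersectingD[OF F(2)] W(1) AB(1) by blast
          then show False using y W(2)[OF AB(1)] by blast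
        qed
      qed (use V i(1) j(1) down in auto)
    qed
  qed
qed

section \<open>Stable sets of the cycle\<close>

definition cyc :: "nat \<Rightarrow> nat \<Rightarrow> nat" where
  "cyc n a = (if a = n then 1 else a + 1)"

definition stables :: "nat \<Rightarrow> nat \<Rightarrow> nat set set" where
  "stables n k = {A \<in> ksets {1..n} k. \<forall>a\<in>A. cyc n a \<notin> A}"

lemma U_verts_eq: "U_verts n k = ksets {1..n} k - stables n k"
proof -
  have "(\<exists>j. 1 \<le> j \<and> j < n \<and> {j, j + 1} \<subseteq> A) \<or> {1, n} \<subseteq> A \<longleftrightarrow> (\<exists>a\<in>A. cyc n a \<in> A)"
    if "A \<subseteq> {1..n}" for A
  proof
    assume "\<exists>a\<in>A. cyc n a \<in> A"
    then obtain a where "a \<in> A" "cyc n a \<in> A" by blast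
    then show "(\<exists>j. 1 \<le> j \<and> j < n \<and> {j, j + 1} \<subseteq> A) \<or> {1, n} \<subseteq> A"
      using that by (cases "a = n") (auto simp: cyc_def intro!: exI[of _ a])
  qed (auto simp: cyc_def)
  then show ?thesis by (auto simp: U_verts_def stables_def ksets_def)
qed

lemma cyc_in: "1 \<le> n \<Longrightarrow> a \<in> {1..n} \<Longrightarrow> cyc n a \<in> {1..n}"
  by (auto simp: cyc_def)

lemma cyc_eq_iff: "a \<in> {1..n} \<Longrightarrow> b \<in> {1..n} \<Longrightarrow> cyc n a = cyc n b \<longleftrightarrow> a = b"
  by (auto simp: cyc_def)

lemma cyc_surj:
  assumes "a \<in> {1..n}"
  shows "\<exists>b\<in>{1..n}. a = cyc n b"
proof (cases "a = 1")
  case True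
  then show ?thesis using assms by (intro bexI[of _ n]) (auto simp: cyc_def)
next
  case False
  then show ?thesis using assms by (intro bexI[of _ "a - 1"]) (auto simp: cyc_def)
qed

lemma cyc_induct:
  assumes "x \<in> {1..n}" "P 1" "\<And>x. x \<in> {1..n} \<Longrightarrow> P x \<Longrightarrow> P (cyc n x)"
  shows "P x"
proof -
  have "1 \<le> x" using assms(1) by simp
  then have "x \<le> n \<longrightarrow> P x"
  proof (induction x rule: dec_induct)
    case (step y)
    then show ?case using assms(3)[of y] by (auto simp: cyc_def)
  qed (use assms(2) in simp)
  then show ?thesis using assms(1) by simp
qed

lemma cyc_image_stables:
  assumes "1 \<le> n" "A \<in> stables n k"
  shows "cyc n ` A \<in> stables n k"
proof -
  have A: "A \<subseteq> {1..n}" "card A = k" "\<forall>a\<in>A. cyc n a \<notin> A"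
    using assms(2) by (auto simp: stables_def ksets_def)
  have inj: "inj_on (cyc n) A"
    using A(1) by (intro inj_onI) (simp add: cyc_eq_iff subset_iff)
  have "cyc n (cyc n a) \<notin> cyc n ` A" if "a \<in> A" for a
  proof
    assume "cyc n (cyc n a) \<in> cyc n ` A"
    then obtain b where b: "b \<in> A" "cyc n (cyc n a) = cyc n b" by blast
    have "cyc n a \<in> {1..n}" using cyc_in[OF assms(1), of a] A(1) that by blast
    then have "cyc n a = b" using b cyc_eq_iff[of "cyc n a" n b] A(1) by blast
    then show False using A(3) that b by blast
  qed
  moreover have "cyc n ` A \<subseteq> {1..n}" using cyc_in[OF assms(1)] A(1) by blast
  ultimately show ?thesis
    using card_image[OF inj] A(2) by (auto simp: stables_def ksets_def)
qed

section \<open>Counting stable sets through a point\<close>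

definition path_stables :: "nat \<Rightarrow> nat \<Rightarrow> nat set set" where
  "path_stables m r = {A \<in> ksets {..<m} r. \<forall>a\<in>A. Suc a \<notin> A}"

text \<open>A stable set using the last point \<open>Suc m\<close> of the longer path avoids
  \<open>m\<close> and is otherwise a stable set of \<open>{..<m}\<close>; the remaining ones live
  on \<open>{..<Suc m}\<close>. This recurrence is Pascal's rule.\<close>

lemma card_path_stables: "card (path_stables m r) = (m + 1 - r) choose r"
proof (induction m arbitrary: r rule: induct_nat_012)
  case 0
  have "path_stables 0 r = (if r = 0 then {{}} else {})"
    by (auto simp: path_stables_def ksets_def)
  then show ?case by (cases r) auto
next
  case 1
  have "path_stables 1 r = (if r = 0 then {{}} else if r = 1 then {{0}} else {})"
    by (auto simp: path_stables_def ksets_def lessThan_Suc subset_singleton_iff)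
  moreover have "r = 0 \<or> r = 1 \<or> (\<exists>s. r = Suc (Suc s))" by presburger
  ultimately show ?case by auto
next
  case (ge2 m)
  show ?case
  proof (cases r)
    case 0
    then have "path_stables (Suc (Suc m)) r = {{}}" by (auto simp: path_stables_def)
    then show ?thesis using 0 by simp
  next
    case (Suc s)
    let ?F = "path_stables (Suc (Suc m)) r"
    have fin: "finite ?F" by (simp add: path_stables_def)
    have "link (Suc m) ?F = path_stables m s"
    proof (intro equalityI subsetI)
      fix A assume "A \<in> link (Suc m) ?F"
      then have A: "Suc m \<notin> A" "insert (Suc m) A \<subseteq> {..<Suc (Suc m)}" "card (insert (Suc m) A) = r"
        "\<forall>a\<in>insert (Suc m) A. Suc a \<notin> insert (Suc m) A"
        by (auto simp: link_def path_stables_def ksets_def)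
      have "finite A" using finite_subset[OF A(2)] by simp
      moreover have "m \<notin> A" using A(4) by auto
      then have "A \<subseteq> {..<m}" using A(1,2) by (auto simp: less_Suc_eq)
      ultimately show "A \<in> path_stables m s"
        using A Suc by (auto simp: path_stables_def ksets_def)
    next
      fix A assume A: "A \<in> path_stables m s"
      then have "finite A" "Suc m \<notin> A" by (auto simp: path_stables_def ksets_def finite_subset)
      then show "A \<in> link (Suc m) ?F"
        using A Suc by (auto simp: link_def path_stables_def ksets_def)
    qed
    moreover have "del (Suc m) ?F = path_stables (Suc m) r"
      by (auto simp: del_def path_stables_def ksets_def less_Suc_eq subset_iff)
    ultimately have c: "card ?F = ((m + 1 - s) choose s) + ((Suc m + 1 - r) choose r)"
      using card_link_del[OF fin, of "Suc m"] ge2.IH by simp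
    show ?thesis
    proof (cases "s \<le> m + 1")
      case True
      then have e: "Suc (Suc m) + 1 - r = Suc (m + 1 - s)" "Suc m + 1 - r = m + 1 - s" using Suc by simp_all
      show ?thesis unfolding c e unfolding Suc by (simp only: binomial_Suc_Suc)
    next
      case False
      \<comment> \<open>All truncated differences are 0 in this case and both sides vanish.\<close>
      then show ?thesis unfolding c using Suc by (cases s) auto
    qed
  qed
qed

text \<open>A stable set through 1 avoids 2 and \<open>n\<close>, so its other points form a stable
  set of the path from 3 to \<open>n - 1\<close>, which is \<open>{..<n - 3}\<close> translated by
  3.\<close>

lemma card_stables_through_1:
  assumes "4 \<le> n" "1 \<le> k"
  shows "card {A \<in> stables n k. 1 \<in> A} = (n - k - 1) choose (k - 1)"
proof -
  let ?f = "\<lambda>B. insert 1 ((\<lambda>y. y + 3) ` B)"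
  have bij: "bij_betw ?f (path_stables (n - 3) (k - 1)) {A \<in> stables n k. 1 \<in> A}"
    unfolding bij_betw_def
  proof (intro conjI equalityI subsetI)
    show "inj_on ?f (path_stables (n - 3) (k - 1))"
    proof (rule inj_onI)
      fix B C :: "nat set" assume e: "?f B = ?f C"
      have "(\<lambda>y. y + 3) ` D = ?f D - {1}" for D :: "nat set" by auto
      then have "(\<lambda>y. y + 3) ` B = (\<lambda>y. y + (3::nat)) ` C" using e by metis
      then show "B = C" by (subst (asm) inj_image_eq_iff) (auto simp: inj_on_def)
    qed
  next
    fix A assume "A \<in> ?f ` path_stables (n - 3) (k - 1)"
    then obtain B where B: "B \<subseteq> {..<n - 3}" "card B = k - 1" "\<forall>a\<in>B. Suc a \<notin> B" "A = ?f B"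
      by (auto simp: path_stables_def ksets_def)
    have "finite B" using finite_subset[OF B(1)] by simp
    then have "card A = k"
      using B(2) assms(2) unfolding B(4) by (subst card_insert_disjoint) (auto simp: card_image)
    moreover have "A \<subseteq> {1..n}" using B(1) assms(1) unfolding B(4) by auto
    moreover have "cyc n a \<notin> A" if "a \<in> A" for a
    proof -
      have "a \<noteq> n" using that B(1) assms(1) unfolding B(4) by auto
      then have "cyc n a = Suc a" by (simp add: cyc_def)
      then show ?thesis using that B(3) unfolding B(4) by auto
    qed
    ultimately show "A \<in> {A \<in> stables n k. 1 \<in> A}"
      unfolding B(4) by (auto simp: stables_def ksets_def)
  next
    fix A assume "A \<in> {A \<in> stables n k. 1 \<in> A}"
    then have A: "A \<subseteq> {1..n}" "card A = k" "\<forall>a\<in>A. cyc n a \<notin> A" "1 \<in> A"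
      by (auto simp: stables_def ksets_def)
    have fin: "finite A" using finite_subset[OF A(1)] by simp
    have "cyc n 1 = 2" using assms(1) by (simp add: cyc_def)
    then have "2 \<notin> A" using A(3,4) by force
    moreover have "n \<notin> A" using A(3,4) by (auto simp: cyc_def)
    ultimately have rest: "3 \<le> a" "a < n" if "a \<in> A - {1}" for a
    proof -
      have "a \<in> {1..n}" "a \<noteq> 1" "a \<noteq> 2" "a \<noteq> n"
        using that A(1) \<open>2 \<notin> A\<close> \<open>n \<notin> A\<close> by auto
      then show "3 \<le> a" "a < n" by auto
    qed
    define B where "B = (\<lambda>a. a - 3) ` (A - {1})"
    have "(\<lambda>y. y + 3) ` B = (\<lambda>a. a - 3 + 3) ` (A - {1})" unfolding B_def by (simp add: image_image)
    also have "\<dots> = A - {1}" using rest(1) by (force simp: image_iff)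
    finally have im: "(\<lambda>y. y + 3) ` B = A - {1}" .
    have "card B = card (A - {1})" unfolding im[symmetric] by (simp add: card_image)
    then have "card B = k - 1" using A(2,4) by simp
    moreover have "B \<subseteq> {..<n - 3}" using rest unfolding B_def by fastforce
    moreover have "Suc b \<notin> B" if "b \<in> B" for b
    proof
      assume "Suc b \<in> B"
      then have "b + 3 \<in> A" "Suc b + 3 \<in> A" "b + 3 < n" using that im rest(2) by blast+
      then show False using A(3) by (auto simp: cyc_def)
    qed
    ultimately have "B \<in> path_stables (n - 3) (k - 1)" by (auto simp: path_stables_def ksets_def)
    moreover have "A = ?f B" unfolding im using A(4) by blast
    ultimately show "A \<in> ?f ` path_stables (n - 3) (k - 1)" by blast
  qed
  have "card {A \<in> stables n k. 1 \<in> A} = (n - 3 + 1 - (k - 1)) choose (k - 1)"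
    using bij_betw_same_card[OF bij] unfolding card_path_stables by (rule sym)
  moreover have "n - 3 + 1 - (k - 1) = n - k - 1" using assms by simp
  ultimately show ?thesis by simp
qed

lemma finite_stables [simp]: "finite (stables n k)"
  by (simp add: stables_def)

text \<open>Rotation maps the stable sets through \<open>x\<close> injectively to those through
  \<open>cyc n x\<close>. The lower bound becomes an upper bound for the vertices through
  \<open>x\<close>.\<close>

lemma card_stables_through:
  assumes "4 \<le> n" "1 \<le> k" "x \<in> {1..n}"
  shows "(n - k - 1) choose (k - 1) \<le> card {A \<in> stables n k. x \<in> A}"
  using assms(3)
proof (rule cyc_induct)
  show "(n - k - 1) choose (k - 1) \<le> card {A \<in> stables n k. 1 \<in> A}"
    using card_stables_through_1[OF assms(1,2)] by simp
next
  fix x assume x: "x \<in> {1..n}" "(n - k - 1) choose (k - 1) \<le> card {A \<in> stables n k. x \<in> A}"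
  have "card {A \<in> stables n k. x \<in> A} \<le> card {A \<in> stables n k. cyc n x \<in> A}"
  proof (rule card_inj_on_le)
    have "inj_on (cyc n) {1..n}" by (intro inj_onI) (simp add: cyc_eq_iff)
    then show "inj_on ((`) (cyc n)) {A \<in> stables n k. x \<in> A}"
      by (intro inj_on_image_Pow[THEN inj_on_subset]) (auto simp: stables_def ksets_def)
    show "(`) (cyc n) ` {A \<in> stables n k. x \<in> A} \<subseteq> {A \<in> stables n k. cyc n x \<in> A}"
      using cyc_image_stables[of n] assms(1) by auto
  qed simp
  then show "(n - k - 1) choose (k - 1) \<le> card {A \<in> stables n k. cyc n x \<in> A}"
    using x(2) by simp
qed

lemma card_U_verts_through:
  assumes "1 \<le> k" "x \<in> {1..n}"
  shows "card {A \<in> U_verts n k. x \<in> A} + card {A \<in> stables n k. x \<in> A} = (n - 1) choose (k - 1)"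
proof -
  let ?F = "{A \<in> ksets {1..n} k. x \<in> A}"
  have "link x ?F = ksets ({1..n} - {x}) (k - 1)"
  proof (intro equalityI subsetI)
    fix A assume "A \<in> link x ?F"
    moreover have "link x ?F \<subseteq> ksets ({1..n} - {x}) (k - 1)"
      by (rule link_ksets) (use assms in \<open>auto simp: insert_absorb\<close>)
    ultimately show "A \<in> ksets ({1..n} - {x}) (k - 1)" by blast
  next
    fix A assume A: "A \<in> ksets ({1..n} - {x}) (k - 1)"
    then have "finite A" "x \<notin> A" by (auto simp: ksets_def finite_subset)
    then show "A \<in> link x ?F" using A assms by (auto simp: link_def ksets_def)
  qed
  moreover have "del x ?F = {}" by (auto simp: del_def)
  ultimately have "card ?F = (n - 1) choose (k - 1)"
    using card_link_del[of ?F x] assms(2) by (simp add: card_ksets)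
  moreover have "?F = {A \<in> U_verts n k. x \<in> A} \<union> {A \<in> stables n k. x \<in> A}"
    by (auto simp: U_verts_eq stables_def)
  then have "card ?F = card {A \<in> U_verts n k. x \<in> A} + card {A \<in> stables n k. x \<in> A}"
    using finite_U_verts by (subst card_Un_disjoint[symmetric]) (auto simp: U_verts_eq)
  ultimately show ?thesis by simp
qed

text \<open>This is what rules out the extremal families. By rotation \<open>x = 1\<close>; a stable
  set with at least \<open>k\<close> points through 1 and \<open>c\<close> is written down and
  trimmed to size \<open>k\<close>.\<close>

lemma stable_through_two:
  assumes "2 \<le> k" "2 * k < n" "x \<in> {1..n}" "c \<in> {1..n}" "c \<noteq> x" "c \<noteq> cyc n x" "cyc n c \<noteq> x"
  shows "\<exists>A\<in>stables n k. x \<in> A \<and> c \<in> A"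
proof -
  let ?P = "\<lambda>x. \<forall>c\<in>{1..n}. c \<noteq> x \<and> c \<noteq> cyc n x \<and> cyc n c \<noteq> x \<longrightarrow> (\<exists>A\<in>stables n k. x \<in> A \<and> c \<in> A)"
  have "?P x" using assms(3)
  proof (rule cyc_induct)
    show "?P 1"
    proof (intro ballI impI)
      fix c assume "c \<in> {1..n}" "c \<noteq> 1 \<and> c \<noteq> cyc n 1 \<and> cyc n c \<noteq> 1"
      then have c: "3 \<le> c" "c < n" using assms(1,2) by (auto simp: cyc_def split: if_splits)
      \<comment> \<open>For odd \<open>c\<close> the odd numbers below \<open>n\<close> are taken,
        for even \<open>c\<close> the number 1 and the even numbers from 4 on;
        \<open>2 * k < n\<close> provides \<open>k\<close> of them. Leaving out \<open>n\<close>
        avoids the adjacency of \<open>n\<close> and 1.\<close>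
      obtain X where X: "finite X" "{1, c} \<subseteq> X" "X \<subseteq> {1..<n}" "k \<le> card X" "\<forall>a\<in>X. Suc a \<notin> X"
      proof (cases "odd c")
        case True
        let ?X = "{y \<in> {1..<n}. odd y}"
        have "(\<lambda>i. 2 * i + 1) ` {..<k} \<subseteq> ?X" using assms(2) by auto
        then have "card ((\<lambda>i. 2 * i + 1) ` {..<k}) \<le> card ?X" by (intro card_mono) auto
        then have "k \<le> card ?X" by (simp add: card_image inj_on_def)
        then show ?thesis by (rule that[of ?X, rotated 3]) (use True c in auto)
      next
        case False
        let ?X = "insert 1 {y \<in> {4..<n}. even y}"
        have "(\<lambda>i. 2 * i + 4) ` {..<k - 1} \<subseteq> {y \<in> {4..<n}. even y}" using assms(1,2) by auto
        then have "card ((\<lambda>i. 2 * i + 4) ` {..<k - 1}) \<le> card {y \<in> {4..<n}. even y}" by (intro card_mono) auto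
        then have "k - 1 \<le> card {y \<in> {4..<n}. even y}" by (simp add: card_image inj_on_def)
        then have "k \<le> card ?X" by simp
        moreover have "c \<noteq> 3" using False by auto
        ultimately show ?thesis by (intro that[of ?X]) (use False c in auto)
      qed
      have "card {1, c} \<le> k" using c assms(1) by simp
      then obtain A where A: "{1, c} \<subseteq> A" "A \<subseteq> X" "card A = k"
        using exists_subset_between[OF _ X(4,2,1)] by blast
      have "cyc n a \<notin> A" if "a \<in> A" for a
        using that A(2) X(3,5) by (auto simp: cyc_def)
      then have "A \<in> stables n k" using A X(3) by (auto simp: stables_def ksets_def)
      then show "\<exists>A\<in>stables n k. 1 \<in> A \<and> c \<in> A" using A(1) by blast
    qed
  next
    fix x assume x: "x \<in> {1..n}" "?P x"
    show "?P (cyc n x)"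
    proof (intro ballI impI)
      fix c' assume c': "c' \<in> {1..n}" "c' \<noteq> cyc n x \<and> c' \<noteq> cyc n (cyc n x) \<and> cyc n c' \<noteq> cyc n x"
      then obtain c where c: "c \<in> {1..n}" "c' = cyc n c" using cyc_surj by blast
      then have "c \<noteq> x" "c \<noteq> cyc n x" "cyc n c \<noteq> x" using c' by auto
      then obtain A where A: "A \<in> stables n k" "x \<in> A" "c \<in> A" using x(2) c(1) by blast
      have "cyc n ` A \<in> stables n k" using cyc_image_stables[OF _ A(1)] assms(2) by simp
      then show "\<exists>A\<in>stables n k. cyc n x \<in> A \<and> c' \<in> A" using A c(2) by blast
    qed
  qed
  then show ?thesis using assms(4-7) by blast
qed

section \<open>Intersecting families of non-stable sets\<close>

lemma card_intersecting_through:
  assumes "4 \<le> n" "1 \<le> k" "x \<in> {1..n}" "F \<subseteq> U_verts n k" "\<forall>A\<in>F. x \<in> A"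
  shows "card F + ((n - k - 1) choose (k - 1)) \<le> (n - 1) choose (k - 1)"
proof -
  have "card F \<le> card {A \<in> U_verts n k. x \<in> A}"
    using assms(4,5) finite_U_verts by (intro card_mono) auto
  then show ?thesis
    using card_stables_through[OF assms(1-3)] card_U_verts_through[OF assms(2,3)] by linarith
qed

text \<open>Complements bound an intersecting family by half of all \<open>k\<close>-sets, which is
  \<open>(2 * k - 1) choose (k - 1)\<close>. The odd numbers form a stable set that meets every
  member, its complement being stable too; adding it to \<open>F\<close> saves 1, the value of the
  other binomial.\<close>

lemma card_intersecting_double:
  assumes "2 \<le> k" "F \<subseteq> U_verts (2 * k) k" "intersecting F"
  shows "card F + ((2 * k - k - 1) choose (k - 1)) \<le> (2 * k - 1) choose (k - 1)"
proof -
  let ?V = "{1..2 * k}"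
  let ?O = "{y \<in> ?V. odd y}" and ?E = "{y \<in> ?V. even y}"
  have "?O = (\<lambda>i. 2 * i + 1) ` {..<k}"
  proof (intro equalityI subsetI)
    fix y assume y: "y \<in> ?O"
    then obtain i where "y = 2 * i + 1" by (auto elim: oddE)
    then show "y \<in> (\<lambda>i. 2 * i + 1) ` {..<k}" using y by auto
  qed auto
  then have cO: "card ?O = k" by (simp add: card_image inj_on_def)
  have OE: "?V = ?O \<union> ?E" "?O \<inter> ?E = {}" by auto
  have "card ?V = card ?O + card ?E" by (subst OE(1), rule card_Un_disjoint) auto
  then have cE: "card ?E = k" using cO by simp
  have stab: "?O \<in> stables (2 * k) k" "?E \<in> stables (2 * k) k"
    using cO cE by (auto simp: stables_def ksets_def cyc_def)
  have F: "F \<subseteq> ksets ?V k" "F \<inter> stables (2 * k) k = {}" using assms(2) by (auto simp: U_verts_eq)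
  have Ok: "?O \<in> ksets ?V k" using stab by (auto simp: stables_def)
  have meets: "A \<inter> ?O \<noteq> {}" if "A \<in> F" for A
  proof
    assume "A \<inter> ?O = {}"
    moreover have A: "A \<subseteq> ?V" "card A = k" using that F(1) by (auto simp: ksets_def)
    ultimately have "A \<subseteq> ?E" using OE(1) by blast
    then have "A = ?E" using card_subset_eq[of ?E A] cE A(2) by simp
    then show False using stab F(2) that by blast
  qed
  have "?O \<noteq> {}" using cO assms(1) by (metis card.empty not_numeral_le_zero)
  then have "intersecting (insert ?O F)"
    using meets assms(3) by (simp add: intersecting_def Int_commute)
  then have "card (insert ?O F) + card (insert ?O F) \<le> card ?V choose k"
    using F(1) Ok unfolding intersecting_def by (intro card_complementary_le) auto
  moreover have "finite F" by (rule finite_subset[OF F(1)]) simp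
  then have "card (insert ?O F) = card F + 1" using stab F(2) by (subst card_insert_disjoint) auto
  moreover obtain m where m: "k = Suc m" using assms(1) by (cases k) auto
  have "2 * k choose k = 2 * ((2 * k - 1) choose (k - 1))"
  proof -
    have "2 * k = Suc (2 * m + 1)" using m by simp
    then have "2 * k choose k = (2 * m + 1 choose m) + (2 * m + 1 choose Suc m)"
      using m by (simp only: binomial_Suc_Suc)
    also have "(2 * m + 1 choose Suc m) = (2 * m + 1 choose m)"
      using binomial_symmetric[of "Suc m" "2 * m + 1"] by simp
    finally show ?thesis using m by simp
  qed
  moreover have "(2 * k - k - 1) choose (k - 1) = 1" using m by simp
  ultimately show ?thesis by simp
qed

text \<open>The vertices are the edges of the cycle here. Next to \<open>{a, cyc n a}\<close>, an
  edge missing \<open>a\<close> has to start at \<open>cyc n a\<close>, and an edge missing that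
  point has to end at \<open>a\<close>; the last two would close a triangle.\<close>

lemma intersecting_cycle_edges:
  assumes "4 \<le> n" "F \<subseteq> U_verts n 2" "intersecting F"
  shows "\<exists>x\<in>{1..n}. \<forall>A\<in>F. x \<in> A"
proof (rule ccontr)
  assume "\<not> ?thesis"
  then have nt: "\<exists>A\<in>F. x \<notin> A" if "x \<in> {1..n}" for x using that by blast
  have n1: "1 \<le> n" using assms(1) by simp
  have edge: "\<exists>a\<in>{1..n}. A = {a, cyc n a}" if "A \<in> F" for A
  proof -
    have A: "A \<in> ksets {1..n} 2" "A \<notin> stables n 2" using that assms(2) by (auto simp: U_verts_eq)
    then obtain a where a: "a \<in> A" "cyc n a \<in> A" by (auto simp: stables_def)
    have "a \<in> {1..n}" "finite A" "card A = 2" using A(1) a ksets_D[of A "{1..n}" 2] by auto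
    moreover have "cyc n a \<noteq> a" using assms(1) by (simp add: cyc_def)
    ultimately show ?thesis
      using a card_seteq[of A "{a, cyc n a}"] by (intro bexI[of _ a]) auto
  qed
  have neq: "cyc n x \<noteq> x" "cyc n (cyc n x) \<noteq> x" "cyc n (cyc n (cyc n x)) \<noteq> x" if "x \<in> {1..n}" for x
    using that assms(1) by (auto simp: cyc_def)
  obtain A where "A \<in> F" using nt[of 1] n1 by auto
  then obtain a where a: "a \<in> {1..n}" "{a, cyc n a} \<in> F" using edge by metis
  obtain B where "B \<in> F" "a \<notin> B" using nt a(1) by blast
  then obtain b where b: "b \<in> {1..n}" "{b, cyc n b} \<in> F" "a \<noteq> b" "a \<noteq> cyc n b" using edge by blast
  have "{a, cyc n a} \<inter> {b, cyc n b} \<noteq> {}" using intersectingD[OF assms(3) a(2) b(2)] .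
  then have b': "b = cyc n a" using b cyc_eq_iff[OF a(1) b(1)] by auto
  obtain C where "C \<in> F" "b \<notin> C" using nt b(1) by blast
  then obtain c where c: "c \<in> {1..n}" "{c, cyc n c} \<in> F" "b \<noteq> c" "b \<noteq> cyc n c" using edge by blast
  have "{a, cyc n a} \<inter> {c, cyc n c} \<noteq> {}" using intersectingD[OF assms(3) a(2) c(2)] .
  then have "a = cyc n c" using c b' by auto
  moreover have "{b, cyc n b} \<inter> {c, cyc n c} \<noteq> {}" using intersectingD[OF assms(3) b(2) c(2)] .
  then have "cyc n b = c \<or> cyc n b = cyc n c" using c by auto
  ultimately show False
    using neq[OF a(1)] neq[OF c(1)] b' cyc_eq_iff[OF b(1) c(1)] c(3) by auto
qed

text \<open>A family violating the bound is \<open>hm_large\<close>, hence has one of the two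
  extremal shapes and contains every set that its shape allows; a stable set is found among
  these.\<close>

lemma card_intersecting_large:
  assumes k: "3 \<le> k" "2 * k < n" and F: "F \<subseteq> U_verts n k" "intersecting F"
    and nt: "\<forall>x\<in>{1..n}. \<exists>A\<in>F. x \<notin> A"
  shows "card F + ((n - k - 1) choose (k - 1)) \<le> (n - 1) choose (k - 1)"
proof (rule ccontr)
  assume "\<not> ?thesis"
  then have large: "hm_large {1..n} k F" by (simp add: hm_large_def)
  have Fk: "F \<subseteq> ksets {1..n} k" using F(1) by (auto simp: U_verts_eq)
  have unst: "A \<notin> F" if "A \<in> stables n k" for A using that F(1) by (auto simp: U_verts_eq)
  have "\<forall>x\<in>{1..n}. del x F \<noteq> {}" using nt by (auto simp: del_def)
  then have "hm_type {1..n} k F"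
    using hilton_milner_structure[OF _ _ k(1) Fk F(2) _ large] k by simp
  then show False unfolding hm_type_def
  proof (elim disjE conjE bexE exE)
    fix x assume x: "x \<in> {1..n}" "card (del x F) = 1"
    then obtain B where B: "del x F = {B}" by (auto simp: card_1_singleton_iff)
    have k1: "1 \<le> k" using k by simp
    have BV: "B \<in> ksets ({1..n} - {x}) k" by (rule hm_star(1)[OF _ x(1) Fk F(2) B k1]) simp
    have li: "link x F = {u \<in> ksets ({1..n} - {x}) (k - 1). u \<inter> B \<noteq> {}}"
      by (rule hm_star(3)[OF _ x(1) Fk F(2) B k1 large]) simp
    have fB: "finite B" "B \<subseteq> {1..n}" "x \<notin> B" "card B = k" using BV by (auto simp: ksets_def finite_subset)
    obtain p where p: "p \<in> {1..n}" "x = cyc n p" using cyc_surj[OF x(1)] by blast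
    \<comment> \<open>The neighbours of \<open>x\<close> on the cycle are \<open>p\<close> and
      \<open>cyc n x\<close>. As \<open>B\<close> has at least three points, some \<open>b\<close>
      in \<open>B\<close> is not adjacent to \<open>x\<close>, and a stable set through
      \<open>x\<close> and \<open>b\<close> is forced into \<open>F\<close>.\<close>
    have "\<not> B \<subseteq> {p, cyc n x}"
    proof
      assume "B \<subseteq> {p, cyc n x}"
      then have "card B \<le> card {p, cyc n x}" by (intro card_mono) auto
      also have "\<dots> \<le> 2" by (simp add: card_insert_if)
      finally show False using fB k by simp
    qed
    then obtain b where b: "b \<in> B" "b \<noteq> p" "b \<noteq> cyc n x" by blast
    have bn: "b \<in> {1..n}" "b \<noteq> x" using b fB by blast+
    have "cyc n b \<noteq> x" using cyc_eq_iff[OF bn(1) p(1)] b(2) p(2) by simp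
    then obtain A where A: "A \<in> stables n k" "x \<in> A" "b \<in> A"
      using stable_through_two[of k n x b] k x(1) bn b(3) by auto
    have "A - {x} \<in> ksets ({1..n} - {x}) (k - 1)"
      using A(1,2) by (auto simp: stables_def ksets_def)
    moreover have "b \<in> (A - {x}) \<inter> B" using A(3) b(1) bn(2) by blast
    ultimately have "A - {x} \<in> link x F" unfolding li by blast
    then show False using unst[OF A(1)] A(2) by (simp add: link_def insert_absorb)
  next
    fix D assume k3: "k = 3" and D: "D \<subseteq> {1..n}" "card D = 3" "\<forall>A\<in>F. 2 \<le> card (A \<inter> D)"
    have T: "F = {A \<in> ksets {1..n} 3. 2 \<le> card (A \<inter> D)}"
      using hm_triple(2)[OF _ _ D(1,2) _ D(3)] Fk large k unfolding k3 by simp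
    \<comment> \<open>Three points of a cycle of length more than 6 are not pairwise
      adjacent.\<close>
    have "\<exists>x\<in>D. \<exists>c\<in>D. c \<noteq> x \<and> c \<noteq> cyc n x \<and> cyc n c \<noteq> x"
    proof -
      obtain a b c where abc: "D = {a, b, c}" "a \<noteq> b" "a \<noteq> c" "b \<noteq> c"
        using D(2) by (auto simp: card_3_iff)
      have n: "a \<in> {1..n}" "b \<in> {1..n}" "c \<in> {1..n}" "6 < n" using D(1) abc k k3 by auto
      have "(b \<noteq> cyc n a \<and> cyc n b \<noteq> a) \<or> (c \<noteq> cyc n a \<and> cyc n c \<noteq> a) \<or> (c \<noteq> cyc n b \<and> cyc n c \<noteq> b)"
        using n abc(2-4) unfolding cyc_def by (auto split: if_splits)
      then show ?thesis using abc by blast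
    qed
    then obtain x c where xc: "x \<in> D" "c \<in> D" "c \<noteq> x" "c \<noteq> cyc n x" "cyc n c \<noteq> x" by blast
    then have "x \<in> {1..n}" "c \<in> {1..n}" using D(1) by blast+
    then obtain A where A: "A \<in> stables n k" "x \<in> A" "c \<in> A"
      using stable_through_two[of k n x c] k xc(3-5) by auto
    have "finite (A \<inter> D)" using D(1) finite_subset by auto
    then have "card {x, c} \<le> card (A \<inter> D)" using A xc by (intro card_mono) auto
    then have "A \<in> F" using A(1) xc(3) k3 unfolding T by (auto simp: stables_def)
    then show False using unst[OF A(1)] by blast
  qed
qed

lemma card_intersecting_U_verts_le:
  assumes "2 \<le> k" "2 * k \<le> n" "F \<subseteq> U_verts n k" "intersecting F"
  shows "card F + ((n - k - 1) choose (k - 1)) \<le> (n - 1) choose (k - 1)"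
proof -
  have n: "4 \<le> n" "1 \<le> k" using assms(1,2) by simp_all
  consider x where "x \<in> {1..n}" "\<forall>A\<in>F. x \<in> A" | "n = 2 * k"
    | "\<forall>x\<in>{1..n}. \<exists>A\<in>F. x \<notin> A" "2 * k < n"
    using assms(2) by fastforce
  then show ?thesis
  proof cases
    case 1
    then show ?thesis by (rule card_intersecting_through[OF n _ assms(3)])
  next
    case 2
    then show ?thesis using card_intersecting_double[OF assms(1)] assms(3,4) by simp
  next
    case 3
    have "k \<noteq> 2"
    proof
      assume "k = 2"
      then have "\<exists>x\<in>{1..n}. \<forall>A\<in>F. x \<in> A"
        using assms(3) by (intro intersecting_cycle_edges[OF n(1) _ assms(4)]) simp
      then show False using 3(1) by blast
    qed
    then have "3 \<le> k" using assms(1) by simp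
    then show ?thesis using card_intersecting_large[OF _ 3(2) assms(3,4) 3(1)] by simp
  qed
qed

theorem theorem5p6:
  fixes n k :: nat
  assumes "k \<ge> 2" and "n \<ge> 2 * k"
  shows "int (independence_number (U n k)) =
    int ((n - 1) choose (k - 1)) - int ((n - k - 1) choose (k - 1))"
proof -
  have n: "4 \<le> n" "1 \<le> k" using assms by simp_all
  have ind: "independent_set (U n k) S \<longleftrightarrow> S \<subseteq> U_verts n k \<and> intersecting S" for S
    by (simp add: independent_set_def U_def intersecting_def) blast
  \<comment> \<open>The vertices through 1 attain the bound.\<close>
  let ?S = "{A \<in> U_verts n k. 1 \<in> A}"
  have S: "card ?S + ((n - k - 1) choose (k - 1)) = (n - 1) choose (k - 1)"
    using card_U_verts_through[OF n(2), of 1 n] card_stables_through_1[OF n] n by simp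
  have "independence_number (U n k) = card ?S"
    unfolding independence_number_def
  proof (rule Max_eqI)
    show "finite {card S | S. independent_set (U n k) S}"
      by (rule finite_independent_set_cards) (simp add: U_def finite_U_verts)
    have "independent_set (U n k) ?S" by (auto simp: ind intersecting_def)
    then show "card ?S \<in> {card S | S. independent_set (U n k) S}" by blast
    fix c assume "c \<in> {card S | S. independent_set (U n k) S}"
    then obtain F where F: "c = card F" "F \<subseteq> U_verts n k" "intersecting F"
      by (auto simp: ind)
    then show "c \<le> card ?S"
      using card_intersecting_U_verts_le[OF assms F(2,3)] S by linarith
  qed
  then show ?thesis using S by linarith
qed

end
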